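(* Let $(X_i,Y_i)_{i\ge1}$ be i.i.d. copies of an $\mathbb R^2$-valued Gaussian random vector $(X,Y)$ with parameter $\theta=(\mu,\Sigma)$ (mean $\mu$, covariance matrix $\Sigma$) and correlation coefficient $\rho$. Consider the test of $H_0:\rho=0$ against $H_1:\rho\ne0$ based on the empirical Pearson correlation coefficient $r_n$ (through the statistic $\sqrt n\,r_n$), large values of the statistic rejecting $H_0$. Then the sequence of empirical coefficients $(r_n)_n$ is asymptotically optimal in the Bahadur sense, i.e. its Bahadur exact slope $c(\theta)$ reaches the upper bound: $c(\theta)=2J(\theta)$ for every $\theta\in\Theta_1$.
   Context: The empirical Pearson correlation coefficient is $$r_n=\frac{\sum_{i=1}^n(X_i-\bar X_n)(Y_i-\bar Y_n)}{\sqrt{\sum_{i=1}^n(X_i-\bar X_n)^2\,\sum_{i=1}^n(Y_i-\bar Y_n)^2}},\qquad \bar X_n=\frac1n\sum_{k=1}^nX_k,\quad \bar Y_n=\frac1n\sum_{k=1}^nY_k .$$ $\Theta$ is the set of parameters $\theta=(\mu,\Sigma)$, $\Theta_0\subset\Theta$ the set of those with $\rho=0$ (i.e. $\Sigma$ diagonal), $\Theta_1=\Theta\setminus\Theta_0$ the set of those with $\rho\neq0$, and $\mu_\theta$ denotes the Gaussian law with parameter $\theta$, with density $\mu_\theta(x)$. For a test statistic $S_n$ whose large values reject $H_0$, put $G_n(t)=\sup_{\theta\in\Theta_0}P_\theta(S_n\ge t)$; the $p$-value is $G_n(S_n)$, and the Bahadur exact slope of $S_n$ at $\theta\in\Theta_1$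 is $$c(\theta)=-2\liminf_{n\to\infty}\frac1n\log G_n(S_n).$$ The Kullback–Leibler information is $K(\theta,\theta_0)=-\int\log\left[\frac{\mu_{\theta_0}(x)}{\mu_\theta(x)}\right]d\mu_\theta$, and $J(\theta)=\inf\{K(\theta,\theta_0):\theta_0\in\Theta_0\}$. One has $c(\theta)\le2J(\theta)$, and a statistic is called optimal (in the Bahadur sense) if this upper bound is reached.
   Formalization: For ρ<0 the claim fails for the signed statistic √n r_n with large values rejecting (the slope is 0, but 2J(θ)>0); so c(θ)=2J(θ) is shown almost surely for |√n r_n| at every θ in Θ_1, and for the signed √n r_n when ρ>0. *)

theory Defs
  imports "HOL-Probability.Probability"
begin

text \<open>A parameter is a pair (mean, covariance matrix). The law has a density, so the covariance
  matrix is required to be positive definite.\<close>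

type_synonym param = "(real^2) \<times> (real^2^2)"

definition Theta :: "param set" where
  "Theta = {(m, C). transpose C = C \<and> (\<forall>v. v \<noteq> 0 \<longrightarrow> 0 < v \<bullet> (C *v v))}"

definition corr :: "param \<Rightarrow> real" where
  "corr \<theta> = snd \<theta> $ 1 $ 2 / sqrt (snd \<theta> $ 1 $ 1 * snd \<theta> $ 2 $ 2)"

definition Theta0 :: "param set" where
  "Theta0 = {\<theta> \<in> Theta. corr \<theta> = 0}"

definition Theta1 :: "param set" where
  "Theta1 = Theta - Theta0"

definition gauss_density :: "param \<Rightarrow> real^2 \<Rightarrow> real" where
  "gauss_density \<theta> x = (case \<theta> of (m, C) \<Rightarrow>
     exp (- ((x - m) \<bullet> (matrix_inv C *v (x - m))) / 2) / (2 * pi * sqrt (det C)))"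

definition gauss_law :: "param \<Rightarrow> (real^2) measure" where
  "gauss_law \<theta> = density lborel (\<lambda>x. ennreal (gauss_density \<theta> x))"

text \<open>A sample is a sequence \<open>z\<close> of which only the terms with index at least 1 are used;
  \<open>z i $ 1\<close> and \<open>z i $ 2\<close> are the i-th observations of the first and of the second variable.\<close>

definition iid_law :: "param \<Rightarrow> (nat \<Rightarrow> real^2) measure" where
  "iid_law \<theta> = PiM {1..} (\<lambda>_. gauss_law \<theta>)"

definition emp_mean :: "2 \<Rightarrow> nat \<Rightarrow> (nat \<Rightarrow> real^2) \<Rightarrow> real" where
  "emp_mean j n z = (\<Sum>k=1..n. z k $ j) / real n"

definition pearson :: "nat \<Rightarrow> (nat \<Rightarrow> real^2) \<Rightarrow> real" where
  "pearson n z =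
     (\<Sum>i=1..n. (z i $ 1 - emp_mean 1 n z) * (z i $ 2 - emp_mean 2 n z)) /
     sqrt ((\<Sum>i=1..n. (z i $ 1 - emp_mean 1 n z)\<^sup>2) * (\<Sum>i=1..n. (z i $ 2 - emp_mean 2 n z)\<^sup>2))"

text \<open>\<open>S n z\<close> is the value of the statistic on the first \<open>n\<close> terms of the sample \<open>z\<close>.\<close>

definition null_tail :: "(nat \<Rightarrow> (nat \<Rightarrow> real^2) \<Rightarrow> real) \<Rightarrow> nat \<Rightarrow> real \<Rightarrow> real" where
  "null_tail S n t = (SUP \<theta>\<in>Theta0. measure (iid_law \<theta>) {z \<in> space (iid_law \<theta>). S n z \<ge> t})"

text \<open>The exact slope is a function of the sample; saying that it equals a constant
  \<open>c(\<theta>)\<close> is meant almost surely when the sample is i.i.d. with parameter \<open>\<theta>\<close>.\<close>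

definition exact_slope :: "(nat \<Rightarrow> (nat \<Rightarrow> real^2) \<Rightarrow> real) \<Rightarrow> (nat \<Rightarrow> real^2) \<Rightarrow> ereal" where
  "exact_slope S z = - (2 * liminf (\<lambda>n. ereal (1 / real n * ln (null_tail S n (S n z)))))"

definition KL_info :: "param \<Rightarrow> param \<Rightarrow> real" where
  "KL_info \<theta> \<theta>0 = - (\<integral>x. ln (gauss_density \<theta>0 x / gauss_density \<theta> x) \<partial>gauss_law \<theta>)"

definition J_info :: "param \<Rightarrow> real" where
  "J_info \<theta> = (INF \<theta>0\<in>Theta0. KL_info \<theta> \<theta>0)"

end

theory Submission
  imports Defs
begin

text \<open>Under \<open>H\<^sub>0\<close> the law of \<open>r\<^sub>n\<close> does not depend on the parameter. Conditionally on the first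
  variable, \<open>\<bar>r\<^sub>n\<bar> \<ge> s\<close> says that a quadratic form in independent standard normals is nonnegative, and
  the exponential Markov inequality gives \<open>P(\<bar>r\<^sub>n\<bar> \<ge> s) \<le> C (1 + \<kappa>) powr (- n / 2)\<close> for every
  \<open>\<kappa> < s\<^sup>2 / (1 - s\<^sup>2)\<close>. Since \<open>r\<^sub>n \<rightarrow> \<rho>\<close> almost surely, the slope is at least \<open>- ln (1 - \<rho>\<^sup>2)\<close>.
  Conversely, by a change of measure the slope is at most \<open>2 K(\<theta>, \<theta>\<^sub>0)\<close> for each \<open>\<theta>\<^sub>0\<close> in \<open>\<Theta>\<^sub>0\<close>. The
  parameter with mean \<open>\<mu>\<close> and the diagonal part of \<open>\<Sigma>\<close> as covariance has
  \<open>2 K(\<theta>, \<theta>\<^sub>0) = - ln (1 - \<rho>\<^sup>2)\<close>, so both bounds agree and equal \<open>2 J(\<theta>)\<close>.\<close>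

section \<open>Gaussian integrals\<close>

text \<open>Only the exponential rate of the null tail matters, so the exact law of the coefficient
  is never computed. With the first sample frozen, the normalised centred first sample e and the
  normalised constant vector f are orthonormal, and a coefficient of absolute value at least s > 0
  forces |y|^2 - (f.y)^2 \<le> (e.y)^2 / s^2. The resulting Gaussian integral is finite exactly when
  \<kappa> / s^2 < 1 + \<kappa>, and each of the n - 2 directions orthogonal to e and f contributes
  1 / sqrt (1 + \<kappa>). At the boundary 1 + \<kappa> = 1 / (1 - s^2), which is the origin of 1 -
  \<rho>^2. The change of measure can be applied to the p-value itself because under each null
  parameter the p-value is stochastically at least uniform. As \<open>ln 0 = 0\<close> in HOL,
  bounding the log p-value from above first needs a positive p-value; the lower bound supplies it.
  Besides measurability and dependence on n observations, the statistic S enters only through S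
  \<le> sqrt n |r| and the limit |\<rho>| of S / sqrt n: always true for the two-sided statistic,
  and for the signed one when \<rho> > 0.\<close>

abbreviation std_gauss :: "real measure" where
  "std_gauss \<equiv> density lborel (\<lambda>x. ennreal (std_normal_density x))"

lemma prob_space_std_gauss: "prob_space std_gauss"
  by (rule prob_space_normal_density) simp

interpretation std_gauss: prob_space std_gauss
  by (rule prob_space_std_gauss)

text \<open>Completing the square turns the tilted standard normal density into a multiple of the
  normal density with mean c / (1 + \<alpha>) and variance 1 / (1 + \<alpha>). Negative \<alpha> is
  allowed because the mixing variables introduced below produce it.\<close>

lemma nn_integral_std_gauss_exp:
  assumes "\<alpha> > -1"
  shows "(\<integral>\<^sup>+ y. ennreal (exp (- (\<alpha> / 2) * y\<^sup>2 + c * y)) \<partial>std_gauss) =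
    ennreal (exp (c\<^sup>2 / (2 * (1 + \<alpha>))) / sqrt (1 + \<alpha>))"
proof -
  define \<sigma> where "\<sigma> = 1 / sqrt (1 + \<alpha>)"
  have \<sigma>: "\<sigma> > 0" "\<sigma>\<^sup>2 = 1 / (1 + \<alpha>)"
    using assms by (auto simp: \<sigma>_def power_divide)
  have eq: "std_normal_density y * exp (- (\<alpha> / 2) * y\<^sup>2 + c * y) =
    exp (c\<^sup>2 / (2 * (1 + \<alpha>))) / sqrt (1 + \<alpha>) * normal_density (c / (1 + \<alpha>)) \<sigma> y" for y
  proof -
    define d where "d = c / (1 + \<alpha>)"
    have c: "c = d * (1 + \<alpha>)"
      using assms by (simp add: d_def)
    have "(d * u)\<^sup>2 / (2 * u) = d\<^sup>2 * u / 2" if "u \<noteq> 0" for u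
      using that by (simp add: power2_eq_square)
    from this[of "1 + \<alpha>"] have "c\<^sup>2 / (2 * (1 + \<alpha>)) = d\<^sup>2 * (1 + \<alpha>) / 2"
      using assms unfolding c by simp
    moreover have "- (y - d)\<^sup>2 / (2 * \<sigma>\<^sup>2) = - (y - d)\<^sup>2 * (1 + \<alpha>) / 2"
      unfolding \<sigma>(2) by simp
    ultimately have "- (y - c / (1 + \<alpha>))\<^sup>2 / (2 * \<sigma>\<^sup>2) + c\<^sup>2 / (2 * (1 + \<alpha>)) =
        - y\<^sup>2 / 2 + (- (\<alpha> / 2) * y\<^sup>2 + c * y)"
      unfolding d_def[symmetric] by (simp add: c algebra_simps power2_eq_square add_divide_distrib diff_divide_distrib)
    hence "exp (- y\<^sup>2 / 2) * exp (- (\<alpha> / 2) * y\<^sup>2 + c * y) =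
        exp (c\<^sup>2 / (2 * (1 + \<alpha>))) * exp (- (y - c / (1 + \<alpha>))\<^sup>2 / (2 * \<sigma>\<^sup>2))"
      by (simp add: exp_add[symmetric] add.commute)
    moreover have "sqrt (2 * pi * \<sigma>\<^sup>2) = sqrt (2 * pi) / sqrt (1 + \<alpha>)"
      unfolding \<sigma>(2) by (simp add: real_sqrt_divide)
    ultimately show ?thesis
      using assms unfolding normal_density_def by (simp add: field_simps)
  qed
  have "(\<integral>\<^sup>+ y. ennreal (exp (- (\<alpha> / 2) * y\<^sup>2 + c * y)) \<partial>std_gauss) =
    (\<integral>\<^sup>+ y. ennreal (exp (c\<^sup>2 / (2 * (1 + \<alpha>))) / sqrt (1 + \<alpha>)) *
      ennreal (normal_density (c / (1 + \<alpha>)) \<sigma> y) \<partial>lborel)"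
  proof -
    have "ennreal (std_normal_density y) * ennreal (exp (- (\<alpha> / 2) * y\<^sup>2 + c * y)) =
      ennreal (exp (c\<^sup>2 / (2 * (1 + \<alpha>))) / sqrt (1 + \<alpha>)) * ennreal (normal_density (c / (1 + \<alpha>)) \<sigma> y)" for y
      using assms eq[of y] by (subst (1 2) ennreal_mult'[symmetric]) auto
    then show ?thesis
      by (subst nn_integral_density) auto
  qed
  also have "\<dots> = ennreal (exp (c\<^sup>2 / (2 * (1 + \<alpha>))) / sqrt (1 + \<alpha>)) *
      (\<integral>\<^sup>+ y. ennreal (normal_density (c / (1 + \<alpha>)) \<sigma> y) \<partial>lborel)"
    by (rule nn_integral_cmult) simp
  also have "(\<integral>\<^sup>+ y. ennreal (normal_density (c / (1 + \<alpha>)) \<sigma> y) \<partial>lborel) = 1"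
    using \<sigma> by (subst nn_integral_eq_integral) auto
  finally show ?thesis by simp
qed

text \<open>The moment generating function of a standard normal variable, read backwards: the square
  in the exponent is linearised at the price of one extra Gaussian variable.\<close>

lemma exp_square_eq_nn_integral:
  assumes "c \<ge> 0"
  shows "ennreal (exp (c / 2 * p\<^sup>2)) = (\<integral>\<^sup>+ t. ennreal (exp (t * (sqrt c * p))) \<partial>std_gauss)"
  using nn_integral_std_gauss_exp[of 0 "sqrt c * p"] assms
  by (simp add: power_mult_distrib mult.commute)

text \<open>Each factor \<open>exp (c p\<^sup>2 / 2)\<close> with \<open>p\<close> linear in \<open>y\<close> is a Gaussian mixture of
  exponentials of linear forms; after exchanging the integrals the coordinates of \<open>y\<close> separate.\<close>

lemma nn_integral_PiM_gauss_exp: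
  fixes e f :: "'i \<Rightarrow> real"
  assumes I: "finite I"
    and e: "(\<Sum>i\<in>I. (e i)\<^sup>2) = 1" and f: "(\<Sum>i\<in>I. (f i)\<^sup>2) = 1" and ef: "(\<Sum>i\<in>I. e i * f i) = 0"
    and \<kappa>: "0 \<le> \<kappa>" and \<mu>: "0 \<le> \<mu>" "\<mu> < 1 + \<kappa>"
  shows "(\<integral>\<^sup>+ y. ennreal (exp (- (\<kappa> / 2) * (\<Sum>i\<in>I. (y i)\<^sup>2) + \<mu> / 2 * (\<Sum>i\<in>I. e i * y i)\<^sup>2
      + \<kappa> / 2 * (\<Sum>i\<in>I. f i * y i)\<^sup>2)) \<partial>PiM I (\<lambda>_. std_gauss)) =
    ennreal ((1 + \<kappa>) / sqrt (1 + \<kappa> - \<mu>) / sqrt (1 + \<kappa>) ^ card I)" (is "?L = _")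
proof -
  interpret I: product_prob_space "\<lambda>_. std_gauss" I ..
  interpret Iy: prob_space "PiM I (\<lambda>_. std_gauss)"
    by (rule I.prob_space_axioms)
  interpret P1: pair_sigma_finite std_gauss "PiM I (\<lambda>_. std_gauss)" ..
  \<comment> \<open>Coefficient of \<open>y i\<close> once both squares are linearised, with
    \<open>s\<close> the mixing variable for the direction \<open>e\<close> and \<open>t\<close> the
    one for \<open>f\<close>.\<close>
  define c where "c s t i = s * sqrt \<mu> * e i + t * sqrt \<kappa> * f i" for s t i
  define F where "F s t y = (\<Prod>i\<in>I. ennreal (exp (- (\<kappa> / 2) * (y i)\<^sup>2 + c s t i * y i)))" for s t y
  have meas [measurable]: "(\<lambda>w. F (u w) (v w) (g w)) \<in> borel_measurable W"
    if [measurable]: "u \<in> borel_measurable W" "v \<in> borel_measurable W" "g \<in> measurable W (PiM I (\<lambda>_. std_gauss))"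
    for u v g and W :: "'w measure"
  proof -
    have [measurable]: "(\<lambda>w. g w i) \<in> borel_measurable W" if "i \<in> I" for i
      using measurable_compose[OF \<open>g \<in> _\<close> measurable_component_singleton[OF that]]
      by (simp cong: measurable_cong_sets)
    show ?thesis unfolding F_def c_def by measurable
  qed
  \<comment> \<open>Orthonormality of \<open>e\<close> and \<open>f\<close> removes the mixed term
    in \<open>s * t\<close>, so the two outer integrals will separate.\<close>
  have sum_c: "(\<Sum>i\<in>I. (c s t i)\<^sup>2) = s\<^sup>2 * \<mu> + t\<^sup>2 * \<kappa>" for s t
  proof -
    have "(\<Sum>i\<in>I. (c s t i)\<^sup>2) = (\<Sum>i\<in>I. s\<^sup>2 * \<mu> * (e i)\<^sup>2 + t\<^sup>2 * \<kappa> * (f i)\<^sup>2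
        + 2 * s * t * sqrt \<mu> * sqrt \<kappa> * (e i * f i))"
      using \<kappa> \<mu> by (intro sum.cong) (auto simp: c_def power2_sum power_mult_distrib)
    also have "\<dots> = s\<^sup>2 * \<mu> * (\<Sum>i\<in>I. (e i)\<^sup>2) + t\<^sup>2 * \<kappa> * (\<Sum>i\<in>I. (f i)\<^sup>2)
        + 2 * s * t * sqrt \<mu> * sqrt \<kappa> * (\<Sum>i\<in>I. e i * f i)"
      by (simp add: sum.distrib sum_distrib_left)
    finally show ?thesis by (simp add: e f ef)
  qed
  \<comment> \<open>The exponents keep the shape of \<open>nn_integral_std_gauss_exp\<close> with c
    = 0 and \<alpha> equal to -\<mu> / (1 + \<kappa>) or -\<kappa> / (1 + \<kappa>). Both exceed -1,
    the first by the hypothesis \<mu> < 1 + \<kappa>.\<close>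
  have inner: "(\<integral>\<^sup>+ y. F s t y \<partial>PiM I (\<lambda>_. std_gauss)) =
      ennreal (1 / sqrt (1 + \<kappa>) ^ card I) * (ennreal (exp (- (- \<mu> / (1 + \<kappa>) / 2) * s\<^sup>2 + 0 * s)) *
       ennreal (exp (- (- \<kappa> / (1 + \<kappa>) / 2) * t\<^sup>2 + 0 * t)))" for s t
  proof -
    have "(\<integral>\<^sup>+ y. F s t y \<partial>PiM I (\<lambda>_. std_gauss)) =
        (\<Prod>i\<in>I. ennreal (exp ((c s t i)\<^sup>2 / (2 * (1 + \<kappa>))) / sqrt (1 + \<kappa>)))"
      unfolding F_def using \<kappa>
      by (subst I.product_nn_integral_prod[OF I]) (simp_all only: nn_integral_std_gauss_exp, simp_all)
    also have "\<dots> = ennreal (exp (\<Sum>i\<in>I. (c s t i)\<^sup>2 / (2 * (1 + \<kappa>))) / sqrt (1 + \<kappa>) ^ card I)"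
      using \<kappa> by (subst prod_ennreal) (auto simp: prod_dividef exp_sum I)
    also have "(\<Sum>i\<in>I. (c s t i)\<^sup>2 / (2 * (1 + \<kappa>))) =
        (- (- \<mu> / (1 + \<kappa>) / 2) * s\<^sup>2 + 0 * s) + (- (- \<kappa> / (1 + \<kappa>) / 2) * t\<^sup>2 + 0 * t)"
    proof -
      have "(s\<^sup>2 * \<mu> + t\<^sup>2 * \<kappa>) / (2 * u) = (- (- \<mu> / u / 2) * s\<^sup>2 + 0 * s) + (- (- \<kappa> / u / 2) * t\<^sup>2 + 0 * t)" for u
        by (simp add: add_divide_distrib mult.commute)
      then show ?thesis by (simp only: sum_divide_distrib[symmetric] sum_c)
    qed
    finally show ?thesis
      using \<kappa> by (simp add: exp_add ennreal_mult'[symmetric] del: mult_minus_left)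
  qed
  have "?L = (\<integral>\<^sup>+ y. (\<integral>\<^sup>+ s. (\<integral>\<^sup>+ t. F s t y \<partial>std_gauss) \<partial>std_gauss) \<partial>PiM I (\<lambda>_. std_gauss))"
  proof (rule nn_integral_cong)
    fix y :: "'i \<Rightarrow> real"
    define p q r where "p = (\<Sum>i\<in>I. e i * y i)" and "q = (\<Sum>i\<in>I. f i * y i)" and "r = (\<Sum>i\<in>I. (y i)\<^sup>2)"
    have F: "F s t y = ennreal (exp (- (\<kappa> / 2) * r)) *
        (ennreal (exp (s * (sqrt \<mu> * p))) * ennreal (exp (t * (sqrt \<kappa> * q))))" for s t
    proof -
      have "F s t y = ennreal (exp (\<Sum>i\<in>I. - (\<kappa> / 2) * (y i)\<^sup>2 + c s t i * y i))"
        unfolding F_def by (subst prod_ennreal) (auto simp: exp_sum I)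
      also have "(\<Sum>i\<in>I. - (\<kappa> / 2) * (y i)\<^sup>2 + c s t i * y i) =
          - (\<kappa> / 2) * r + (s * (sqrt \<mu> * p) + t * (sqrt \<kappa> * q))"
        by (simp add: c_def p_def q_def r_def sum.distrib sum_distrib_left algebra_simps sum_subtractf sum_negf)
      finally show ?thesis by (simp only: exp_add ennreal_mult' exp_ge_zero)
    qed
    have "ennreal (exp (- (\<kappa> / 2) * r + \<mu> / 2 * p\<^sup>2 + \<kappa> / 2 * q\<^sup>2)) =
        ennreal (exp (- (\<kappa> / 2) * r)) * (ennreal (exp (\<mu> / 2 * p\<^sup>2)) * ennreal (exp (\<kappa> / 2 * q\<^sup>2)))"
      by (simp only: exp_add ennreal_mult' exp_ge_zero mult.assoc)
    also have "\<dots> = (\<integral>\<^sup>+ s. (\<integral>\<^sup>+ t. F s t y \<partial>std_gauss) \<partial>std_gauss)"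
      unfolding F exp_square_eq_nn_integral[OF \<mu>(1)] exp_square_eq_nn_integral[OF \<kappa>]
      by (simp add: nn_integral_cmult nn_integral_multc)
    finally show "ennreal (exp (- (\<kappa> / 2) * (\<Sum>i\<in>I. (y i)\<^sup>2) + \<mu> / 2 * (\<Sum>i\<in>I. e i * y i)\<^sup>2
      + \<kappa> / 2 * (\<Sum>i\<in>I. f i * y i)\<^sup>2)) = (\<integral>\<^sup>+ s. (\<integral>\<^sup>+ t. F s t y \<partial>std_gauss) \<partial>std_gauss)"
      by (simp add: p_def q_def r_def)
  qed
  also have "\<dots> = (\<integral>\<^sup>+ s. (\<integral>\<^sup>+ y. (\<integral>\<^sup>+ t. F s t y \<partial>std_gauss) \<partial>PiM I (\<lambda>_. std_gauss)) \<partial>std_gauss)"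
    by (rule P1.Fubini') measurable
  also have "\<dots> = (\<integral>\<^sup>+ s. (\<integral>\<^sup>+ t. (\<integral>\<^sup>+ y. F s t y \<partial>PiM I (\<lambda>_. std_gauss)) \<partial>std_gauss) \<partial>std_gauss)"
    by (intro nn_integral_cong P1.Fubini') measurable
  also have "\<dots> = ennreal (1 / sqrt (1 + \<kappa>) ^ card I) *
      ((\<integral>\<^sup>+ s. ennreal (exp (- (- \<mu> / (1 + \<kappa>) / 2) * s\<^sup>2 + 0 * s)) \<partial>std_gauss) *
       (\<integral>\<^sup>+ t. ennreal (exp (- (- \<kappa> / (1 + \<kappa>) / 2) * t\<^sup>2 + 0 * t)) \<partial>std_gauss))"
    unfolding inner by (simp add: nn_integral_cmult nn_integral_multc)
  also have "\<dots> = ennreal (1 / sqrt (1 + \<kappa>) ^ card I) *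
      (ennreal (1 / sqrt (1 + (- \<mu> / (1 + \<kappa>)))) * ennreal (1 / sqrt (1 + (- \<kappa> / (1 + \<kappa>)))))"
    using \<kappa> \<mu> by (subst (1 2) nn_integral_std_gauss_exp) (auto simp: field_simps)
  also have "\<dots> = ennreal (1 / sqrt (1 + \<kappa>) ^ card I *
      (1 / sqrt (1 + (- \<mu> / (1 + \<kappa>))) * (1 / sqrt (1 + (- \<kappa> / (1 + \<kappa>))))))"
  proof -
    have "0 \<le> 1 / sqrt (1 + (- \<mu> / (1 + \<kappa>)))" "0 \<le> 1 / sqrt (1 + \<kappa>) ^ card I"
      using \<kappa> \<mu> by (auto simp: field_simps)
    then show ?thesis by (simp only: ennreal_mult'[symmetric])
  qed
  \<comment> \<open>The direction \<open>f\<close> returns a full factor sqrt (1 + \<kappa>), since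
    its square cancels the damping completely; the direction \<open>e\<close> returns sqrt ((1 +
    \<kappa>) / (1 + \<kappa> - \<mu>)).\<close>
  also have "1 / sqrt (1 + (- \<mu> / (1 + \<kappa>))) * (1 / sqrt (1 + (- \<kappa> / (1 + \<kappa>)))) =
      (1 + \<kappa>) / sqrt (1 + \<kappa> - \<mu>)"
  proof -
    have "1 + (- \<mu> / (1 + \<kappa>)) = (1 + \<kappa> - \<mu>) / (1 + \<kappa>)" "1 + (- \<kappa> / (1 + \<kappa>)) = 1 / (1 + \<kappa>)"
      using \<kappa> by (auto simp: field_simps)
    moreover have "sqrt (1 + \<kappa>) * sqrt (1 + \<kappa>) = 1 + \<kappa>"
      using \<kappa> by simp
    ultimately show ?thesis by (simp add: real_sqrt_divide)
  qed
  finally show ?thesis by (simp add: mult.commute)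
qed

section \<open>The null distribution of the empirical correlation\<close>

text \<open>This is n times the empirical covariance. Keeping the two coordinates as separate
  sequences allows the first to be frozen while the second is integrated.\<close>

definition cross_dev :: "nat \<Rightarrow> (nat \<Rightarrow> real) \<Rightarrow> (nat \<Rightarrow> real) \<Rightarrow> real" where
  "cross_dev n x y =
     (\<Sum>i=1..n. (x i - (\<Sum>k=1..n. x k) / real n) * (y i - (\<Sum>k=1..n. y k) / real n))"

definition corr_coeff :: "nat \<Rightarrow> (nat \<Rightarrow> real) \<Rightarrow> (nat \<Rightarrow> real) \<Rightarrow> real" where
  "corr_coeff n x y = cross_dev n x y / sqrt (cross_dev n x x * cross_dev n y y)"

lemma pearson_eq_corr_coeff: "pearson n z = corr_coeff n (\<lambda>i. z i $ 1) (\<lambda>i. z i $ 2)"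
  by (simp add: pearson_def corr_coeff_def cross_dev_def emp_mean_def power2_eq_square)

lemma cross_dev_cong:
  "(\<And>i. i \<in> {1..n} \<Longrightarrow> x i = x' i) \<Longrightarrow> (\<And>i. i \<in> {1..n} \<Longrightarrow> y i = y' i) \<Longrightarrow>
    cross_dev n x y = cross_dev n x' y'"
  unfolding cross_dev_def by (intro sum.cong arg_cong2[where f = "(*)"] arg_cong2[where f = "(-)"]
      arg_cong2[where f = "(/)"]) auto

lemma corr_coeff_cong:
  "(\<And>i. i \<in> {1..n} \<Longrightarrow> x i = x' i) \<Longrightarrow> (\<And>i. i \<in> {1..n} \<Longrightarrow> y i = y' i) \<Longrightarrow>
    corr_coeff n x y = corr_coeff n x' y'"
  unfolding corr_coeff_def
  by (intro arg_cong2[where f = "(/)"] arg_cong[where f = sqrt] arg_cong2[where f = "(*)"] cross_dev_cong) auto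

lemma pearson_cong: "(\<And>i. i \<in> {1..n} \<Longrightarrow> z i = z' i) \<Longrightarrow> pearson n z = pearson n z'"
  unfolding pearson_eq_corr_coeff by (rule corr_coeff_cong) auto

lemma sum_dev_eq_0: "n > 0 \<Longrightarrow> (\<Sum>i=1..n. x i - (\<Sum>k=1..n. x k) / real n) = 0"
  by (simp add: sum_subtractf)

text \<open>Deviations from the mean sum to zero, so centring one factor is enough. For fixed
  \<open>x\<close> this exhibits a linear form in the raw values of \<open>y\<close>.\<close>

lemma cross_dev_eq_left: "cross_dev n x y = (\<Sum>i=1..n. (x i - (\<Sum>k=1..n. x k) / real n) * y i)"
proof (cases "n = 0")
  case False
  then have "(\<Sum>i=1..n. (x i - (\<Sum>k=1..n. x k) / real n) * ((\<Sum>k=1..n. y k) / real n)) = 0"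
    using sum_dev_eq_0[of n x] by (subst sum_distrib_right[symmetric]) auto
  then show ?thesis
    by (simp add: cross_dev_def right_diff_distrib sum_subtractf)
qed (simp add: cross_dev_def)

lemma cross_dev_eq: "cross_dev n x y = (\<Sum>i=1..n. x i * y i) - (\<Sum>i=1..n. x i) * (\<Sum>i=1..n. y i) / real n"
proof -
  have "(\<Sum>i=1..n. X / real n * y i) = X * (\<Sum>i=1..n. y i) / real n" for X
    by (simp add: sum_distrib_left sum_divide_distrib)
  then show ?thesis
    by (simp only: cross_dev_eq_left left_diff_distrib sum_subtractf)
qed

lemma cross_dev_self_nonneg: "0 \<le> cross_dev n x x"
  unfolding cross_dev_def by (intro sum_nonneg) simp

lemma cross_dev_affine: "cross_dev n (\<lambda>i. a + b * x i) (\<lambda>i. c + d * y i) = b * d * cross_dev n x y"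
proof (cases "n = 0")
  case False
  then have "a + b * x i - (\<Sum>k=1..n. a + b * x k) / real n = b * (x i - (\<Sum>k=1..n. x k) / real n)"
    "c + d * y i - (\<Sum>k=1..n. c + d * y k) / real n = d * (y i - (\<Sum>k=1..n. y k) / real n)" for i
    by (simp_all add: sum.distrib sum_distrib_left[symmetric] field_simps)
  then show ?thesis
    by (simp add: cross_dev_def sum_distrib_left mult.assoc mult.left_commute)
qed (simp add: cross_dev_def)

text \<open>Invariance under location and scale is the reason why the null law is free of the
  parameter: at zero correlation the coordinates are increasing affine images of independent
  standard normals.\<close>

lemma corr_coeff_affine:
  assumes "b > 0" "d > 0"
  shows "corr_coeff n (\<lambda>i. a + b * x i) (\<lambda>i. c + d * y i) = corr_coeff n x y"
proof -
  have "b * b * X * (d * d * Y) = (b * d)\<^sup>2 * (X * Y)" for X Y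
    by (simp add: power2_eq_square)
  then show ?thesis
    using assms by (simp add: corr_coeff_def cross_dev_affine real_sqrt_mult)
qed

section \<open>Tail of the coefficient when the first sample is fixed\<close>

lemma measurable_corr_coeff:
  assumes [measurable]: "\<And>i. i \<in> {1..n} \<Longrightarrow> X i \<in> borel_measurable W" "\<And>i. i \<in> {1..n} \<Longrightarrow> Y i \<in> borel_measurable W"
  shows "(\<lambda>w. corr_coeff n (\<lambda>i. X i w) (\<lambda>i. Y i w)) \<in> borel_measurable W"
  unfolding corr_coeff_def cross_dev_def by measurable

text \<open>Division by zero gives 0 in HOL, so a coefficient bounded away from 0 excludes constant
  samples; then the inequality can be squared and cleared of denominators.\<close>

lemma corr_coeff_square_le:
  assumes "0 < s" "s \<le> \<bar>corr_coeff n x y\<bar>"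
  shows "0 < cross_dev n x x" "s\<^sup>2 * cross_dev n y y \<le> (cross_dev n x y)\<^sup>2 / cross_dev n x x"
proof -
  have "corr_coeff n x y \<noteq> 0" using assms by auto
  then have nz: "cross_dev n x x \<noteq> 0" "cross_dev n y y \<noteq> 0"
    by (auto simp: corr_coeff_def)
  then show pos: "0 < cross_dev n x x"
    using cross_dev_self_nonneg[of n x] by linarith
  have posy: "0 < cross_dev n y y"
    using nz cross_dev_self_nonneg[of n y] by linarith
  have "s\<^sup>2 \<le> (corr_coeff n x y)\<^sup>2"
    using power_mono[OF assms(2), of 2] assms(1) by simp
  also have "\<dots> = (cross_dev n x y)\<^sup>2 / (cross_dev n x x * cross_dev n y y)"
    using pos posy by (simp add: corr_coeff_def power_divide)
  finally show "s\<^sup>2 * cross_dev n y y \<le> (cross_dev n x y)\<^sup>2 / cross_dev n x x"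
    using pos posy by (simp add: field_simps)
qed

text \<open>The factor independent of n in \<open>nn_integral_PiM_gauss_exp\<close> at \<mu> =
  \<kappa> / s^2. It explodes at the boundary value of \<kappa>, but for fixed \<open>s\<close> and
  \<kappa> it disappears from the exponential rate.\<close>

definition tail_const :: "real \<Rightarrow> real \<Rightarrow> real" where
  "tail_const s \<kappa> = (1 + \<kappa>) / sqrt (1 + \<kappa> - \<kappa> / s\<^sup>2)"

text \<open>Exponential Markov inequality: the indicator of the event is dominated by the
  exponential of a quadratic form that is nonnegative on the event. The bound does not involve
  \<open>x\<close>, so it can be averaged over \<open>x\<close> afterwards.\<close>

lemma emeasure_corr_coeff_given_first:
  fixes x :: "nat \<Rightarrow> real" and n :: nat
  assumes s: "0 < s" and \<kappa>: "0 \<le> \<kappa>" "\<kappa> / s\<^sup>2 < 1 + \<kappa>"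
  defines "P \<equiv> PiM {1..n} (\<lambda>_. std_gauss)"
  shows "emeasure P {y \<in> space P. s \<le> \<bar>corr_coeff n x y\<bar>} \<le>
    ennreal (tail_const s \<kappa> / sqrt (1 + \<kappa>) ^ n)"
proof (cases "0 < cross_dev n x x")
  case False
  then have empty: "{y \<in> space P. s \<le> \<bar>corr_coeff n x y\<bar>} = {}"
    using corr_coeff_square_le(1)[OF s] by blast
  show ?thesis unfolding empty by simp
next
  case True
  then have n: "n > 0" by (cases n) (auto simp: cross_dev_def)
  \<comment> \<open>The unit vector along the centred first sample and the unit vector along the
    constants; they are orthogonal because the centred sample sums to zero.\<close>
  define e where "e i = (x i - (\<Sum>k=1..n. x k) / real n) / sqrt (cross_dev n x x)" for i
  define f :: "nat \<Rightarrow> real" where "f i = 1 / sqrt (real n)" for i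
  have ee: "(\<Sum>i=1..n. (e i)\<^sup>2) = 1"
    using True by (simp add: e_def power_divide sum_divide_distrib[symmetric])
      (simp add: cross_dev_def power2_eq_square)
  have ff: "(\<Sum>i=1..n. (f i)\<^sup>2) = 1"
    using n by (simp add: f_def power_divide)
  have ef: "(\<Sum>i=1..n. e i * f i) = 0"
    using sum_dev_eq_0[OF n, of x] by (simp add: e_def f_def sum_divide_distrib[symmetric])
  have [measurable]: "{y \<in> space P. s \<le> \<bar>corr_coeff n x y\<bar>} \<in> sets P"
    unfolding P_def by (measurable, intro measurable_corr_coeff) (auto cong: measurable_cong_sets)
  have "emeasure P {y \<in> space P. s \<le> \<bar>corr_coeff n x y\<bar>} =
      (\<integral>\<^sup>+ y. indicator {y \<in> space P. s \<le> \<bar>corr_coeff n x y\<bar>} y \<partial>P)"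
    by simp
  also have "\<dots> \<le> (\<integral>\<^sup>+ y. ennreal (exp (- (\<kappa> / 2) * (\<Sum>i=1..n. (y i)\<^sup>2) +
      \<kappa> / s\<^sup>2 / 2 * (\<Sum>i=1..n. e i * y i)\<^sup>2 + \<kappa> / 2 * (\<Sum>i=1..n. f i * y i)\<^sup>2)) \<partial>P)"
  proof (intro nn_integral_mono)
    fix y
    have p: "(\<Sum>i=1..n. e i * y i)\<^sup>2 = (cross_dev n x y)\<^sup>2 / cross_dev n x x"
      using True by (simp add: e_def cross_dev_eq_left[of n x y] sum_divide_distrib[symmetric] power_divide)
    have q: "(\<Sum>i=1..n. f i * y i)\<^sup>2 = (\<Sum>i=1..n. y i)\<^sup>2 / real n"
      by (simp add: f_def sum_divide_distrib[symmetric] power_divide)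
    \<comment> \<open>The form equals \<kappa> / 2 times the difference of p^2 / s^2 and the centred
      sum of squares of \<open>y\<close>, the \<open>f\<close> term performing the centring.\<close>
    have "0 \<le> - (\<kappa> / 2) * (\<Sum>i=1..n. (y i)\<^sup>2) + \<kappa> / s\<^sup>2 / 2 * (\<Sum>i=1..n. e i * y i)\<^sup>2
        + \<kappa> / 2 * (\<Sum>i=1..n. f i * y i)\<^sup>2" if "s \<le> \<bar>corr_coeff n x y\<bar>"
    proof -
      have "\<kappa> / (2 * s\<^sup>2) * (s\<^sup>2 * cross_dev n y y) \<le>
          \<kappa> / (2 * s\<^sup>2) * ((cross_dev n x y)\<^sup>2 / cross_dev n x x)"
        using \<kappa> corr_coeff_square_le(2)[OF s that] by (intro mult_left_mono) auto
      moreover have "cross_dev n y y = (\<Sum>i=1..n. (y i)\<^sup>2) - (\<Sum>i=1..n. y i)\<^sup>2 / real n"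
        by (simp add: cross_dev_eq power2_eq_square)
      ultimately show ?thesis
        using s unfolding p q by (simp add: algebra_simps)
    qed
    then show "indicator {y \<in> space P. s \<le> \<bar>corr_coeff n x y\<bar>} y \<le>
      ennreal (exp (- (\<kappa> / 2) * (\<Sum>i=1..n. (y i)\<^sup>2) +
      \<kappa> / s\<^sup>2 / 2 * (\<Sum>i=1..n. e i * y i)\<^sup>2 + \<kappa> / 2 * (\<Sum>i=1..n. f i * y i)\<^sup>2))"
      by (auto simp: indicator_def ennreal_1[symmetric] simp del: ennreal_1 intro!: ennreal_leI)
  qed
  also have "\<dots> = ennreal (tail_const s \<kappa> / sqrt (1 + \<kappa>) ^ n)"
    unfolding P_def tail_const_def using \<kappa> by (subst nn_integral_PiM_gauss_exp[OF _ ee ff ef]) auto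
  finally show ?thesis .
qed

text \<open>Independent copies of a function of a pair can be drawn from two independent i.i.d.
  sequences. On rectangles the indicator is a product over \<open>I\<close>, and applying the
  product formula to the inner and then to the outer integral reassembles the factors.\<close>

lemma PiM_distr_pair_measure:
  assumes I: "finite I" and A: "prob_space A" and B: "prob_space B"
    and g [measurable]: "g \<in> measurable (A \<Otimes>\<^sub>M B) C"
  shows "PiM I (\<lambda>_. distr (A \<Otimes>\<^sub>M B) C g) =
    distr (PiM I (\<lambda>_. A) \<Otimes>\<^sub>M PiM I (\<lambda>_. B)) (PiM I (\<lambda>_. C)) (\<lambda>(x, y). \<lambda>i\<in>I. g (x i, y i))"
    (is "PiM I (\<lambda>_. ?D) = ?R")
proof -
  interpret A: prob_space A by fact
  interpret B: prob_space B by fact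
  interpret AB: pair_prob_space A B ..
  interpret D: prob_space ?D by (intro AB.prob_space_distr g)
  interpret PD: product_prob_space "\<lambda>_. ?D" I ..
  interpret PA: product_prob_space "\<lambda>_. A" I ..
  interpret PB: product_prob_space "\<lambda>_. B" I ..
  have gm [measurable]: "(\<lambda>p. g (fst p i, snd p i)) \<in> measurable (PiM I (\<lambda>_. A) \<Otimes>\<^sub>M PiM I (\<lambda>_. B)) C" if "i \<in> I" for i
    using that by measurable
  have m: "(\<lambda>(x, y). \<lambda>i\<in>I. g (x i, y i)) \<in>
      measurable (PiM I (\<lambda>_. A) \<Otimes>\<^sub>M PiM I (\<lambda>_. B)) (PiM I (\<lambda>_. C))"
    unfolding split_beta by (intro measurable_restrict gm)
  have "?R = PiM I (\<lambda>_. ?D)"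
  proof (rule PD.PiM_eqI[OF I])
    show "sets ?R = sets (PiM I (\<lambda>_. ?D))"
      by (simp cong: sets_PiM_cong)
  next
    fix E assume "\<And>i. i \<in> I \<Longrightarrow> E i \<in> sets ?D"
    then have E [measurable]: "\<And>i. i \<in> I \<Longrightarrow> E i \<in> sets C" by simp
    have PE [measurable]: "Pi\<^sub>E I E \<in> sets (PiM I (\<lambda>_. C))"
      using I E by (intro sets_PiM_I_finite) auto
    have "emeasure ?R (Pi\<^sub>E I E) = (\<integral>\<^sup>+ w. indicator (Pi\<^sub>E I E) w \<partial>?R)"
      by simp
    also have "\<dots> = (\<integral>\<^sup>+ p. indicator (Pi\<^sub>E I E) ((\<lambda>(x, y). \<lambda>i\<in>I. g (x i, y i)) p)
        \<partial>(PiM I (\<lambda>_. A) \<Otimes>\<^sub>M PiM I (\<lambda>_. B)))"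
      by (intro nn_integral_distr m) simp
    also have "\<dots> = (\<integral>\<^sup>+ p. (\<Prod>i\<in>I. indicator (E i) (g (fst p i, snd p i))) \<partial>(PiM I (\<lambda>_. A) \<Otimes>\<^sub>M PiM I (\<lambda>_. B)))"
      using I by (intro nn_integral_cong) (auto simp: indicator_def split_beta PiE_iff)
    also have "\<dots> = (\<integral>\<^sup>+ x. (\<integral>\<^sup>+ y. (\<Prod>i\<in>I. indicator (E i) (g (x i, y i))) \<partial>PiM I (\<lambda>_. B)) \<partial>PiM I (\<lambda>_. A))"
      by (subst PB.nn_integral_fst[symmetric]) auto
    also have "\<dots> = (\<integral>\<^sup>+ x. (\<Prod>i\<in>I. \<integral>\<^sup>+ y. indicator (E i) (g (x i, y)) \<partial>B) \<partial>PiM I (\<lambda>_. A))"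
    proof (intro nn_integral_cong)
      fix x assume x: "x \<in> space (PiM I (\<lambda>_. A))"
      have "(\<lambda>y. indicator (E i) (g (x i, y)) :: ennreal) \<in> borel_measurable B" if i: "i \<in> I" for i
      proof -
        have [measurable]: "x i \<in> space A" using x i by (auto simp: space_PiM)
        have "(\<lambda>y. g (x i, y)) \<in> measurable B C" by measurable
        then show ?thesis using E[OF i] by measurable
      qed
      then show "(\<integral>\<^sup>+ y. (\<Prod>i\<in>I. indicator (E i) (g (x i, y i)) :: ennreal) \<partial>PiM I (\<lambda>_. B)) =
          (\<Prod>i\<in>I. \<integral>\<^sup>+ y. indicator (E i) (g (x i, y)) \<partial>B)"
        by (intro PB.product_nn_integral_prod[OF I])
    qed
    also have "\<dots> = (\<Prod>i\<in>I. \<integral>\<^sup>+ x. \<integral>\<^sup>+ y. indicator (E i) (g (x, y)) \<partial>B \<partial>A)"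
      by (intro PA.product_nn_integral_prod[OF I]) measurable
    also have "\<dots> = (\<Prod>i\<in>I. emeasure ?D (E i))"
    proof (intro prod.cong refl)
      fix i assume i: "i \<in> I"
      have "emeasure ?D (E i) = (\<integral>\<^sup>+ w. indicator (E i) w \<partial>?D)"
        using E[OF i] by simp
      also have "\<dots> = (\<integral>\<^sup>+ p. indicator (E i) (g p) \<partial>(A \<Otimes>\<^sub>M B))"
        using E[OF i] by (subst nn_integral_distr) auto
      also have "\<dots> = (\<integral>\<^sup>+ x. \<integral>\<^sup>+ y. indicator (E i) (g (x, y)) \<partial>B \<partial>A)"
        using E[OF i] by (subst B.nn_integral_fst[symmetric]) auto
      finally show "(\<integral>\<^sup>+ x. \<integral>\<^sup>+ y. indicator (E i) (g (x, y)) \<partial>B \<partial>A) = emeasure ?D (E i)" ..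
    qed
    finally show "emeasure ?R (Pi\<^sub>E I E) = (\<Prod>i\<in>I. emeasure ?D (E i))" .
  qed
  then show ?thesis ..
qed

section \<open>Passage from pairs of reals to bivariate samples\<close>

lemma borel_measurable_vec_nth_comp [measurable (raw)]:
  "f \<in> borel_measurable W \<Longrightarrow> (\<lambda>w. f w $ i :: real) \<in> borel_measurable W"
  by (rule measurable_compose[OF _ borel_measurable_continuous_onI[OF
        linear_continuous_on[OF bounded_linear_vec_nth]]])

lemma vector_2_eq: "vector [a, b] = (\<chi> i. if i = 1 then a else b :: real^2)"
  by (simp add: vec_eq_iff forall_2 vector_2)

lemma borel_measurable_vector_2 [measurable]:
  fixes f g :: "'w \<Rightarrow> real"
  assumes [measurable]: "f \<in> borel_measurable W" "g \<in> borel_measurable W"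
  shows "(\<lambda>w. vector [f w, g w] :: real^2) \<in> borel_measurable W"
proof -
  have "continuous_on UNIV (\<lambda>p. if i = 1 then fst p else snd p :: real)" for i :: 2
    by (cases "i = 1") (auto intro!: continuous_intros)
  then have "(\<lambda>p :: real \<times> real. vector [fst p, snd p] :: real^2) \<in> borel_measurable borel"
    unfolding vector_2_eq by (intro borel_measurable_continuous_onI continuous_on_vec_lambda)
  from measurable_compose[OF borel_measurable_Pair[OF assms] this] show ?thesis
    by simp
qed

text \<open>The constants \<open>a\<close>, \<open>b\<close>, \<open>c\<close>, \<open>d\<close>
  drop out by affine invariance; the conditional bound is then integrated over the first sample with
  Tonelli.\<close>

lemma emeasure_pearson_std:
  fixes n :: nat and a b c d :: real
  assumes s: "0 < s" and \<kappa>: "0 \<le> \<kappa>" "\<kappa> / s\<^sup>2 < 1 + \<kappa>" and b: "0 < b" and d: "0 < d"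
  defines "G \<equiv> distr (std_gauss \<Otimes>\<^sub>M std_gauss) borel (\<lambda>(x, y). vector [a + b * x, c + d * y] :: real^2)"
  defines "P \<equiv> PiM {1..n} (\<lambda>_. G)"
  shows "emeasure P {z \<in> space P. s \<le> \<bar>pearson n z\<bar>} \<le> ennreal (tail_const s \<kappa> / sqrt (1 + \<kappa>) ^ n)"
proof -
  define g :: "real \<times> real \<Rightarrow> real^2" where "g = (\<lambda>(x, y). vector [a + b * x, c + d * y])"
  define N where "N = PiM {1..n} (\<lambda>_. std_gauss)"
  interpret N: product_prob_space "\<lambda>_. std_gauss" "{1..n}" ..
  interpret N: prob_space N unfolding N_def by (rule N.prob_space_axioms)
  have "(\<lambda>(x, y). vector [a + b * x, c + d * y] :: real^2) \<in> borel_measurable (borel \<Otimes>\<^sub>M borel)"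
    unfolding split_beta by measurable
  then have g [measurable]: "g \<in> borel_measurable (std_gauss \<Otimes>\<^sub>M std_gauss)"
    unfolding g_def by (simp cong: measurable_cong_sets sets_pair_measure_cong)
  have P: "P = distr (N \<Otimes>\<^sub>M N) (PiM {1..n} (\<lambda>_. borel)) (\<lambda>(x, y). \<lambda>i\<in>{1..n}. g (x i, y i))"
    unfolding P_def G_def g_def[symmetric] N_def
    by (intro PiM_distr_pair_measure std_gauss.prob_space_axioms g) simp
  have [measurable]: "(\<lambda>p. g (fst p i, snd p i)) \<in> borel_measurable (N \<Otimes>\<^sub>M N)" if "i \<in> {1..n}" for i
    using that unfolding N_def by measurable
  have m [measurable]: "(\<lambda>(x, y). \<lambda>i\<in>{1..n}. g (x i, y i)) \<in> measurable (N \<Otimes>\<^sub>M N) (PiM {1..n} (\<lambda>_. borel))"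
    unfolding split_beta by (intro measurable_restrict) measurable
  have "pearson n \<in> borel_measurable (PiM {1..n} (\<lambda>_. borel :: (real^2) measure))"
    unfolding pearson_eq_corr_coeff
    by (intro measurable_corr_coeff) measurable
  then have [measurable]: "{z \<in> space (PiM {1..n} (\<lambda>_. borel :: (real^2) measure)). s \<le> \<bar>pearson n z\<bar>}
      \<in> sets (PiM {1..n} (\<lambda>_. borel))" by measurable
  have cc: "pearson n (\<lambda>i\<in>{1..n}. g (x i, y i)) = corr_coeff n x y" for x y
  proof -
    have "pearson n (\<lambda>i\<in>{1..n}. g (x i, y i)) = corr_coeff n (\<lambda>i. a + b * x i) (\<lambda>i. c + d * y i)"
      unfolding pearson_eq_corr_coeff by (intro corr_coeff_cong) (auto simp: g_def vector_2)
    then show ?thesis using b d by (simp add: corr_coeff_affine)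
  qed
  have set: "{p \<in> space (N \<Otimes>\<^sub>M N). s \<le> \<bar>corr_coeff n (fst p) (snd p)\<bar>} \<in> sets (N \<Otimes>\<^sub>M N)"
    unfolding N_def by (measurable, intro measurable_corr_coeff) (auto cong: measurable_cong_sets)
  have "emeasure P {z \<in> space P. s \<le> \<bar>pearson n z\<bar>} =
      emeasure (N \<Otimes>\<^sub>M N) {p \<in> space (N \<Otimes>\<^sub>M N). s \<le> \<bar>corr_coeff n (fst p) (snd p)\<bar>}"
    unfolding P using measurable_space[OF m]
    by (subst emeasure_distr) (auto intro!: arg_cong2[where f = emeasure] simp: cc split_beta simp del: One_nat_def)
  also have "\<dots> = (\<integral>\<^sup>+ x. emeasure N {y \<in> space N. s \<le> \<bar>corr_coeff n x y\<bar>} \<partial>N)"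
    by (subst N.emeasure_pair_measure_alt[OF set])
       (auto intro!: nn_integral_cong arg_cong2[where f = emeasure] simp: space_pair_measure)
  also have "\<dots> \<le> (\<integral>\<^sup>+ x. ennreal (tail_const s \<kappa> / sqrt (1 + \<kappa>) ^ n) \<partial>N)"
    unfolding N_def by (intro nn_integral_mono emeasure_corr_coeff_given_first s \<kappa>)
  also have "\<dots> = ennreal (tail_const s \<kappa> / sqrt (1 + \<kappa>) ^ n)"
    by (simp add: N.emeasure_space_1)
  finally show ?thesis .
qed

section \<open>A strong law for square integrable variables\<close>

text \<open>For k^2 \<le> n < (k + 1)^2, monotonicity traps S n / n between the averages at these
  two squares, up to the ratio of the squares, which tends to 1.\<close>

lemma mono_average_tendsto_of_squares:
  fixes S :: "nat \<Rightarrow> real"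
  assumes mono: "mono S" and nn: "\<And>n. 0 \<le> S n"
    and lim: "(\<lambda>k. S ((Suc k)\<^sup>2) / real ((Suc k)\<^sup>2)) \<longlonglongrightarrow> \<mu>"
  shows "(\<lambda>n. S n / real n) \<longlonglongrightarrow> \<mu>"
proof -
  define a where "a k = S (k\<^sup>2) / real (k\<^sup>2)" for k
  have a: "a \<longlonglongrightarrow> \<mu>"
    using lim unfolding a_def by (rule LIMSEQ_imp_Suc)
  have r1: "(\<lambda>k. (real k)\<^sup>2 / (real (Suc k))\<^sup>2) \<longlonglongrightarrow> 1" 
    using tendsto_power[OF LIMSEQ_n_over_Suc_n, of 2] by (simp add: power_divide)
  have r2: "(\<lambda>k. (real (Suc k))\<^sup>2 / (real k)\<^sup>2) \<longlonglongrightarrow> 1"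
    using tendsto_inverse[OF r1] by (simp add: inverse_eq_divide)
  have sqrt: "filterlim floor_sqrt at_top sequentially"
    unfolding filterlim_at_top by (auto simp: eventually_sequentially le_floor_sqrt_iff intro!: exI)
  have low: "(\<lambda>n. a (floor_sqrt n) * ((real (floor_sqrt n))\<^sup>2 / (real (Suc (floor_sqrt n)))\<^sup>2)) \<longlonglongrightarrow> \<mu>"
    using filterlim_compose[OF tendsto_mult[OF a r1] sqrt] by simp
  have up: "(\<lambda>n. a (Suc (floor_sqrt n)) * ((real (Suc (floor_sqrt n)))\<^sup>2 / (real (floor_sqrt n))\<^sup>2)) \<longlonglongrightarrow> \<mu>"
    using filterlim_compose[OF tendsto_mult[OF LIMSEQ_Suc[OF a] r2] sqrt] by simp
  show ?thesis
  proof (rule tendsto_sandwich[OF _ _ low up])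
    show "\<forall>\<^sub>F n in sequentially. a (floor_sqrt n) * ((real (floor_sqrt n))\<^sup>2 / (real (Suc (floor_sqrt n)))\<^sup>2) \<le> S n / real n"
      using eventually_gt_at_top[of 0]
    proof eventually_elim
      case (elim n)
      have "S ((floor_sqrt n)\<^sup>2) / real ((Suc (floor_sqrt n))\<^sup>2) \<le> S n / real n"
        using elim Suc_floor_sqrt_power2_gt[of n] nn
        by (intro frac_le monoD[OF mono]) (auto simp del: power_Suc of_nat_power)
      then show ?case using elim by (simp add: a_def del: of_nat_Suc)
    qed
    show "\<forall>\<^sub>F n in sequentially. S n / real n \<le> a (Suc (floor_sqrt n)) * ((real (Suc (floor_sqrt n)))\<^sup>2 / (real (floor_sqrt n))\<^sup>2)"
      using eventually_gt_at_top[of 0]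
    proof eventually_elim
      case (elim n)
      have "S n / real n \<le> S ((Suc (floor_sqrt n))\<^sup>2) / real ((floor_sqrt n)\<^sup>2)"
        using elim Suc_floor_sqrt_power2_gt[of n] nn
        by (intro frac_le monoD[OF mono]) (auto simp del: power_Suc of_nat_power)
      then show ?case by (simp add: a_def del: of_nat_Suc)
    qed
  qed
qed

text \<open>Expanding the square leaves only the diagonal, since independence and centring make the
  mixed expectations vanish.\<close>

lemma (in prob_space) expectation_square_sum_centered:
  fixes Y :: "nat \<Rightarrow> 'a \<Rightarrow> real"
  assumes indep: "indep_vars (\<lambda>_. borel) Y {1..}"
    and sq: "\<And>i. 1 \<le> i \<Longrightarrow> integrable M (\<lambda>\<omega>. (Y i \<omega>)\<^sup>2)"
    and Y: "\<And>i. 1 \<le> i \<Longrightarrow> integrable M (Y i)" "\<And>i. 1 \<le> i \<Longrightarrow> expectation (Y i) = 0"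
    and var: "\<And>i. 1 \<le> i \<Longrightarrow> expectation (\<lambda>\<omega>. (Y i \<omega>)\<^sup>2) = v"
  shows "integrable M (\<lambda>\<omega>. (\<Sum>i=1..n. Y i \<omega>)\<^sup>2)"
    and "expectation (\<lambda>\<omega>. (\<Sum>i=1..n. Y i \<omega>)\<^sup>2) = real n * v"
proof -
  have prod: "integrable M (\<lambda>\<omega>. Y i \<omega> * Y j \<omega>) \<and>
      expectation (\<lambda>\<omega>. Y i \<omega> * Y j \<omega>) = (if i = j then v else 0)" if ij: "1 \<le> i" "1 \<le> j" for i j
  proof (cases "i = j")
    case True
    then show ?thesis using sq[OF ij(1)] var[OF ij(1)] by (simp add: power2_eq_square)
  next
    case False
    have ind: "indep_vars (\<lambda>_. borel) Y {i, j}"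
      using ij by (intro indep_vars_subset[OF indep]) auto
    have int: "\<And>k. k \<in> {i, j} \<Longrightarrow> integrable M (Y k)"
      using ij Y(1) by auto
    have "integrable M (\<lambda>\<omega>. \<Prod>k\<in>{i, j}. Y k \<omega>)"
      "expectation (\<lambda>\<omega>. \<Prod>k\<in>{i, j}. Y k \<omega>) = (\<Prod>k\<in>{i, j}. expectation (Y k))"
      using indep_vars_integrable[OF _ ind int] indep_vars_lebesgue_integral[OF _ ind int] by auto
    then show ?thesis using False ij Y(2) by simp
  qed
  have eq: "(\<lambda>\<omega>. (\<Sum>i=1..n. Y i \<omega>)\<^sup>2) = (\<lambda>\<omega>. \<Sum>i=1..n. \<Sum>j=1..n. Y i \<omega> * Y j \<omega>)"
    by (simp add: power2_eq_square sum_product)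
  show "integrable M (\<lambda>\<omega>. (\<Sum>i=1..n. Y i \<omega>)\<^sup>2)"
    unfolding eq using prod by (intro Bochner_Integration.integrable_sum) auto
  have "expectation (\<lambda>\<omega>. \<Sum>i=1..n. \<Sum>j=1..n. Y i \<omega> * Y j \<omega>) =
      (\<Sum>i=1..n. expectation (\<lambda>\<omega>. \<Sum>j=1..n. Y i \<omega> * Y j \<omega>))"
    using prod by (intro Bochner_Integration.integral_sum Bochner_Integration.integrable_sum) auto
  also have "\<dots> = (\<Sum>i=1..n. \<Sum>j=1..n. expectation (\<lambda>\<omega>. Y i \<omega> * Y j \<omega>))"
    using prod by (intro sum.cong refl Bochner_Integration.integral_sum) auto
  also have "\<dots> = (\<Sum>i=1..n. \<Sum>j=1..n. if i = j then v else 0)"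
    using prod by (intro sum.cong refl) auto
  finally have "expectation (\<lambda>\<omega>. (\<Sum>i=1..n. Y i \<omega>)\<^sup>2) = (\<Sum>i=1..n. \<Sum>j=1..n. if i = j then v else 0)"
    unfolding eq .
  then show "expectation (\<lambda>\<omega>. (\<Sum>i=1..n. Y i \<omega>)\<^sup>2) = real n * v"
    by simp
qed

lemma integrable_of_square_integrable:
  fixes f :: "'a \<Rightarrow> real"
  assumes "prob_space M" "f \<in> borel_measurable M" "integrable M (\<lambda>x. (f x)\<^sup>2)"
  shows "integrable M f"
proof -
  interpret prob_space M by fact
  have "\<bar>f x\<bar> \<le> 1 + (f x)\<^sup>2" for x
    using zero_le_power2[of "\<bar>f x\<bar> - 1"] by (simp add: power2_diff)
  then show ?thesis
    using assms by (intro Bochner_Integration.integrable_bound[of M "\<lambda>x. 1 + (f x)\<^sup>2" f]) auto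
qed

text \<open>Second moments alone give convergence along the squares, where the variances of the
  averages are summable; nonnegativity makes the partial sums monotone, which fills the gaps between
  squares.\<close>

lemma (in prob_space) strong_law_nonneg:
  fixes X :: "nat \<Rightarrow> 'a \<Rightarrow> real"
  assumes indep: "indep_vars (\<lambda>_. borel) X {1..}"
    and nn: "\<And>i \<omega>. 0 \<le> X i \<omega>"
    and sq: "\<And>i. 1 \<le> i \<Longrightarrow> integrable M (\<lambda>\<omega>. (X i \<omega>)\<^sup>2)"
    and mean: "\<And>i. 1 \<le> i \<Longrightarrow> expectation (X i) = \<mu>"
    and second: "\<And>i. 1 \<le> i \<Longrightarrow> expectation (\<lambda>\<omega>. (X i \<omega>)\<^sup>2) = q"
  shows "AE \<omega> in M. (\<lambda>n. (\<Sum>i=1..n. X i \<omega>) / real n) \<longlonglongrightarrow> \<mu>"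
proof -
  have meas [measurable]: "X i \<in> borel_measurable M" if "1 \<le> i" for i
    using indep that by (auto simp: indep_vars_def)
  have int: "integrable M (X i)" if "1 \<le> i" for i
    by (rule integrable_of_square_integrable[OF prob_space_axioms meas[OF that] sq[OF that]])
  define Y where "Y i \<omega> = X i \<omega> - \<mu>" for i \<omega>
  have ind: "indep_vars (\<lambda>_. borel) Y {1..}"
    unfolding Y_def by (rule indep_vars_compose2[OF indep, of "\<lambda>_ x. x - \<mu>"]) auto
  have sqY: "integrable M (\<lambda>\<omega>. (Y i \<omega>)\<^sup>2)" "expectation (\<lambda>\<omega>. (Y i \<omega>)\<^sup>2) = q - \<mu>\<^sup>2" if "1 \<le> i" for i
  proof -
    have "(\<lambda>\<omega>. (Y i \<omega>)\<^sup>2) = (\<lambda>\<omega>. (X i \<omega>)\<^sup>2 - 2 * \<mu> * X i \<omega> + \<mu>\<^sup>2)"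
      by (auto simp: Y_def power2_diff)
    then show "integrable M (\<lambda>\<omega>. (Y i \<omega>)\<^sup>2)" "expectation (\<lambda>\<omega>. (Y i \<omega>)\<^sup>2) = q - \<mu>\<^sup>2"
      using int[OF that] sq[OF that] mean[OF that] second[OF that]
      by (simp_all add: prob_space) (simp add: power2_eq_square)
  qed
  have Yint: "integrable M (Y i)" "expectation (Y i) = 0" if "1 \<le> i" for i
    using int[OF that] mean[OF that] by (simp_all add: Y_def[abs_def] prob_space)
  note SY = expectation_square_sum_centered[OF ind sqY(1) Yint sqY(2)]
  \<comment> \<open>Centred average of the first (k + 1)^2 terms, with second moment (q - \<mu>^2) /
    (k + 1)^2. The shift keeps the number of terms positive.\<close>
  define D where "D k \<omega> = (\<Sum>i=1..(Suc k)\<^sup>2. Y i \<omega>) / real ((Suc k)\<^sup>2)" for k \<omega>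
  have Dm [measurable]: "D k \<in> borel_measurable M" for k
    unfolding D_def Y_def by measurable
  have D: "(\<integral>\<^sup>+ \<omega>. ennreal ((D k \<omega>)\<^sup>2) \<partial>M) = ennreal ((q - \<mu>\<^sup>2) * (1 / (real (Suc k))\<^sup>2))" for k
  proof -
    have "(\<integral>\<^sup>+ \<omega>. ennreal ((D k \<omega>)\<^sup>2) \<partial>M) = ennreal (expectation (\<lambda>\<omega>. (D k \<omega>)\<^sup>2))"
      using SY(1)[of "(Suc k)\<^sup>2"] by (intro nn_integral_eq_integral) (auto simp: D_def power_divide)
    also have "expectation (\<lambda>\<omega>. (D k \<omega>)\<^sup>2) = (q - \<mu>\<^sup>2) * (1 / (real (Suc k))\<^sup>2)"
    proof -
      have "expectation (\<lambda>\<omega>. ((\<Sum>i=1..N. Y i \<omega>) / real N)\<^sup>2) = (q - \<mu>\<^sup>2) * (1 / real N)" if "N > 0" for N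
        using SY(2)[of N] that by (simp add: power_divide) (simp add: power2_eq_square)
      from this[of "(Suc k)\<^sup>2"] show ?thesis
        unfolding D_def of_nat_power by simp
    qed
    finally show ?thesis .
  qed
  have "q - \<mu>\<^sup>2 = expectation (\<lambda>\<omega>. (Y 1 \<omega>)\<^sup>2)" using sqY(2)[of 1] by simp
  then have v: "0 \<le> q - \<mu>\<^sup>2" by simp
  have summ: "summable (\<lambda>k. (q - \<mu>\<^sup>2) * (1 / (real (Suc k))\<^sup>2))"
    using inverse_power_summable[of 2, where ?'a = real]
    by (intro summable_mult) (subst summable_Suc_iff, simp add: inverse_eq_divide)
  \<comment> \<open>The expected sum of all squared deviations is finite, so the sum is finite
    almost surely and its terms tend to 0.\<close>
  have "(\<integral>\<^sup>+ \<omega>. (\<Sum>k. ennreal ((D k \<omega>)\<^sup>2)) \<partial>M) = (\<Sum>k. ennreal ((q - \<mu>\<^sup>2) * (1 / (real (Suc k))\<^sup>2)))"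
    by (subst nn_integral_suminf) (auto simp: D)
  also have "\<dots> \<noteq> \<infinity>"
    using v by (subst suminf_ennreal2[OF _ summ]) auto
  finally have "AE \<omega> in M. (\<Sum>k. ennreal ((D k \<omega>)\<^sup>2)) \<noteq> \<infinity>"
    by (intro nn_integral_PInf_AE) auto
  then show ?thesis
  proof eventually_elim
    case (elim \<omega>)
    then have "summable (\<lambda>k. (D k \<omega>)\<^sup>2)"
      by (intro summable_suminf_not_top) auto
    then have "(\<lambda>k. (D k \<omega>)\<^sup>2) \<longlonglongrightarrow> 0"
      by (rule summable_LIMSEQ_zero)
    then have "(\<lambda>k. D k \<omega>) \<longlonglongrightarrow> 0"
      using tendsto_real_sqrt[of "\<lambda>k. (D k \<omega>)\<^sup>2" 0] by (simp add: tendsto_rabs_zero_iff)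
    moreover have "D k \<omega> = (\<Sum>i=1..(Suc k)\<^sup>2. X i \<omega>) / real ((Suc k)\<^sup>2) - \<mu>" for k
      by (simp add: D_def Y_def sum_subtractf diff_divide_distrib del: of_nat_Suc)
    ultimately have "(\<lambda>k. (\<Sum>i=1..(Suc k)\<^sup>2. X i \<omega>) / real ((Suc k)\<^sup>2)) \<longlonglongrightarrow> \<mu>"
      by (simp only: LIM_zero_iff)
    then show ?case
      by (intro mono_average_tendsto_of_squares monoI sum_mono2 sum_nonneg nn) auto
  qed
qed

text \<open>The positive and negative parts of \<open>h\<close> are nonnegative and bounded by |h|,
  so both are square integrable and the nonnegative case applies to each.\<close>

lemma (in prob_space) strong_law:
  fixes Z :: "nat \<Rightarrow> 'a \<Rightarrow> 'b" and h :: "'b \<Rightarrow> real"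
  assumes indep: "indep_vars (\<lambda>_. N) Z {1..}"
    and distr: "\<And>i. 1 \<le> i \<Longrightarrow> distr M N (Z i) = G"
    and h [measurable]: "h \<in> borel_measurable N" and sq: "integrable G (\<lambda>x. (h x)\<^sup>2)"
  shows "AE \<omega> in M. (\<lambda>n. (\<Sum>i=1..n. h (Z i \<omega>)) / real n) \<longlonglongrightarrow> (\<integral>x. h x \<partial>G)"
proof -
  have Z [measurable]: "Z i \<in> measurable M N" if "1 \<le> i" for i
    using indep that by (auto simp: indep_vars_def)
  interpret G: prob_space G
    using prob_space_distr[OF Z, of 1] distr[of 1] by simp
  have [measurable_cong]: "sets G = sets N"
    using distr[of 1] by auto
  have nonneg: "AE \<omega> in M. (\<lambda>n. (\<Sum>i=1..n. g (Z i \<omega>)) / real n) \<longlonglongrightarrow> (\<integral>x. g x \<partial>G)"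
    if [measurable]: "g \<in> borel_measurable N" and g: "\<And>x. 0 \<le> g x" "\<And>x. g x \<le> \<bar>h x\<bar>" for g
  proof (rule strong_law_nonneg)
    have sqg: "integrable G (\<lambda>x. (g x)\<^sup>2)"
      using g by (intro Bochner_Integration.integrable_bound[OF sq, of "\<lambda>x. (g x)\<^sup>2"]) (auto simp: abs_le_square_iff[symmetric])
    show "indep_vars (\<lambda>_. borel) (\<lambda>i \<omega>. g (Z i \<omega>)) {1..}"
      by (rule indep_vars_compose2[OF indep]) auto
    fix i :: nat assume i: "1 \<le> i"
    show "integrable M (\<lambda>\<omega>. (g (Z i \<omega>))\<^sup>2)"
      using sqg i unfolding distr[OF i, symmetric] by (subst (asm) integrable_distr_eq) auto
    show "expectation (\<lambda>\<omega>. g (Z i \<omega>)) = (\<integral>x. g x \<partial>G)"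
      using i unfolding distr[OF i, symmetric] by (subst integral_distr) auto
    show "expectation (\<lambda>\<omega>. (g (Z i \<omega>))\<^sup>2) = (\<integral>x. (g x)\<^sup>2 \<partial>G)"
      using i unfolding distr[OF i, symmetric] by (subst integral_distr) auto
  qed (use g in auto)
  have "integrable G h"
    by (rule integrable_of_square_integrable[OF G.prob_space_axioms _ sq]) measurable
  then have int: "integrable G (\<lambda>x. max 0 (h x))" "integrable G (\<lambda>x. max 0 (- h x))"
    by auto
  have lim: "(\<integral>x. h x \<partial>G) = (\<integral>x. max 0 (h x) \<partial>G) - (\<integral>x. max 0 (- h x) \<partial>G)"
    unfolding Bochner_Integration.integral_diff[OF int, symmetric]
    by (intro Bochner_Integration.integral_cong) auto
  have "AE \<omega> in M. (\<lambda>n. (\<Sum>i=1..n. max 0 (h (Z i \<omega>))) / real n) \<longlonglongrightarrow> (\<integral>x. max 0 (h x) \<partial>G)"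
    "AE \<omega> in M. (\<lambda>n. (\<Sum>i=1..n. max 0 (- h (Z i \<omega>))) / real n) \<longlonglongrightarrow> (\<integral>x. max 0 (- h x) \<partial>G)"
    by (rule nonneg; auto)+
  then show ?thesis
  proof eventually_elim
    case (elim \<omega>)
    have "(\<Sum>i=1..n. max 0 (h (Z i \<omega>))) / real n - (\<Sum>i=1..n. max 0 (- h (Z i \<omega>))) / real n =
        (\<Sum>i=1..n. h (Z i \<omega>)) / real n" for n
      unfolding diff_divide_distrib[symmetric] sum_subtractf[symmetric]
      by (intro arg_cong2[where f = "(/)"] sum.cong) auto
    then show ?case
      using tendsto_diff[OF elim] unfolding lim by simp
  qed
qed

section \<open>The Gaussian law as an image of standard normals\<close>

text \<open>\<open>matrix_inv\<close> is a choice among two-sided inverses, so its value has to be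
  pinned down by uniqueness.\<close>

lemma matrix_inv_eqI:
  fixes A B :: "real^'n^'n"
  assumes "A ** B = mat 1" "B ** A = mat 1"
  shows "matrix_inv A = B"
proof -
  have "A ** matrix_inv A = mat 1 \<and> matrix_inv A ** A = mat 1"
    unfolding matrix_inv_def by (rule someI[of _ B]) (use assms in auto)
  then have "matrix_inv A = (B ** A) ** matrix_inv A"
    using assms by (simp add: matrix_mul_lid)
  also have "\<dots> = B"
    using \<open>A ** matrix_inv A = mat 1 \<and> _\<close> by (simp add: matrix_mul_assoc[symmetric] matrix_mul_rid)
  finally show ?thesis .
qed

lemma ThetaD:
  assumes "\<theta> \<in> Theta"
  defines "C \<equiv> snd \<theta>"
  shows "C $ 2 $ 1 = C $ 1 $ 2" "0 < C $ 1 $ 1" "0 < C $ 2 $ 2" "(C $ 1 $ 2)\<^sup>2 < C $ 1 $ 1 * C $ 2 $ 2"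
proof -
  obtain m where \<theta>: "\<theta> = (m, C)"
    unfolding C_def by (metis prod.collapse)
  then have sym: "transpose C = C" and pos: "\<And>v. v \<noteq> 0 \<Longrightarrow> 0 < v \<bullet> (C *v v)"
    using assms(1) by (auto simp: Theta_def)
  show C21: "C $ 2 $ 1 = C $ 1 $ 2"
    using arg_cong[OF sym, of "\<lambda>A. A $ 1 $ 2"] by (simp add: transpose_def)
  have quad: "0 < C $ 1 $ 1 * a\<^sup>2 + 2 * C $ 1 $ 2 * (a * b) + C $ 2 $ 2 * b\<^sup>2" if "a \<noteq> 0 \<or> b \<noteq> 0" for a b
  proof -
    have "(vector [a, b] :: real^2) \<noteq> 0"
      using that by (auto simp: vec_eq_iff forall_2 vector_2)
    from pos[OF this] show ?thesis
      by (simp add: inner_vec_def matrix_vector_mult_def sum_2 vector_2 C21 algebra_simps power2_eq_square)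
  qed
  show C11: "0 < C $ 1 $ 1" and "0 < C $ 2 $ 2"
    using quad[of 1 0] quad[of 0 1] by auto
  \<comment> \<open>At the vector (C12, -C11) the quadratic form equals C11 times the
    determinant.\<close>
  have "0 < C $ 1 $ 1 * (C $ 1 $ 1 * C $ 2 $ 2 - (C $ 1 $ 2)\<^sup>2)"
    using quad[of "C $ 1 $ 2" "- C $ 1 $ 1"] C11 by (simp add: algebra_simps power2_eq_square)
  then show "(C $ 1 $ 2)\<^sup>2 < C $ 1 $ 1 * C $ 2 $ 2"
    using C11 by (simp add: zero_less_mult_iff)
qed

definition sd :: "2 \<Rightarrow> param \<Rightarrow> real" where
  "sd j \<theta> = sqrt (snd \<theta> $ j $ j)"

text \<open>Standard deviation of the residual when the standardised second variable is regressed on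
  the first.\<close>

definition resid_sd :: "param \<Rightarrow> real" where
  "resid_sd \<theta> = sqrt (1 - (corr \<theta>)\<^sup>2)"

lemma Theta_params:
  assumes "\<theta> \<in> Theta"
  shows "0 < sd 1 \<theta>" "0 < sd 2 \<theta>" "\<bar>corr \<theta>\<bar> < 1" "0 < resid_sd \<theta>" "(resid_sd \<theta>)\<^sup>2 = 1 - (corr \<theta>)\<^sup>2"
    "snd \<theta> $ 1 $ 1 = (sd 1 \<theta>)\<^sup>2" "snd \<theta> $ 2 $ 2 = (sd 2 \<theta>)\<^sup>2"
    "snd \<theta> $ 1 $ 2 = corr \<theta> * sd 1 \<theta> * sd 2 \<theta>" "snd \<theta> $ 2 $ 1 = corr \<theta> * sd 1 \<theta> * sd 2 \<theta>"
proof -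
  note C = ThetaD[OF assms]
  show s: "0 < sd 1 \<theta>" "0 < sd 2 \<theta>" and s2: "snd \<theta> $ 1 $ 1 = (sd 1 \<theta>)\<^sup>2" "snd \<theta> $ 2 $ 2 = (sd 2 \<theta>)\<^sup>2"
    using C by (auto simp: sd_def)
  have corr: "corr \<theta> = snd \<theta> $ 1 $ 2 / (sd 1 \<theta> * sd 2 \<theta>)"
    by (simp add: corr_def sd_def real_sqrt_mult)
  then show C12: "snd \<theta> $ 1 $ 2 = corr \<theta> * sd 1 \<theta> * sd 2 \<theta>"
    using s by simp
  then show "snd \<theta> $ 2 $ 1 = corr \<theta> * sd 1 \<theta> * sd 2 \<theta>"
    using C by simp
  have "(corr \<theta>)\<^sup>2 * ((sd 1 \<theta>)\<^sup>2 * (sd 2 \<theta>)\<^sup>2) < 1 * ((sd 1 \<theta>)\<^sup>2 * (sd 2 \<theta>)\<^sup>2)"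
    using C(4) unfolding C12 s2 by (simp add: power_mult_distrib mult.assoc)
  then have "(corr \<theta>)\<^sup>2 < 1"
    using s by (subst (asm) mult_less_cancel_right_pos) auto
  moreover from this have "(corr \<theta>)\<^sup>2 \<le> 1" by simp
  ultimately show "\<bar>corr \<theta>\<bar> < 1" "0 < resid_sd \<theta>" "(resid_sd \<theta>)\<^sup>2 = 1 - (corr \<theta>)\<^sup>2"
    by (simp_all add: resid_sd_def abs_square_less_1[symmetric])
qed

lemma gauss_density_eq:
  assumes "\<theta> \<in> Theta"
  defines "r \<equiv> corr \<theta>"
  defines "u x \<equiv> (x $ 1 - fst \<theta> $ 1) / sd 1 \<theta>" and "v x \<equiv> (x $ 2 - fst \<theta> $ 2) / sd 2 \<theta>"
  shows "gauss_density \<theta> x = exp (- ((u x)\<^sup>2 - 2 * r * u x * v x + (v x)\<^sup>2) / (2 * (1 - r\<^sup>2))) /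
    (2 * pi * (sd 1 \<theta> * sd 2 \<theta> * resid_sd \<theta>))"
proof -
  note p = Theta_params[OF assms(1), folded r_def]
  obtain m C where \<theta>: "\<theta> = (m, C)" by (cases \<theta>)
  define s1 s2 where "s1 = sd 1 \<theta>" and "s2 = sd 2 \<theta>"
  note p = p[folded s1_def s2_def, unfolded \<theta> snd_conv]
  have r1: "1 - r\<^sup>2 > 0" using p(3) by (simp add: abs_square_less_1)
  \<comment> \<open>The inverse covariance written in standard deviations and correlation, to be
    verified by multiplication.\<close>
  define D :: "real^2^2" where "D = vector [vector [1 / (s1\<^sup>2 * (1 - r\<^sup>2)), - r / (s1 * s2 * (1 - r\<^sup>2))],
    vector [- r / (s1 * s2 * (1 - r\<^sup>2)), 1 / (s2\<^sup>2 * (1 - r\<^sup>2))]]"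
  have D: "D $ 1 $ 1 = 1 / (s1\<^sup>2 * (1 - r\<^sup>2))" "D $ 1 $ 2 = - r / (s1 * s2 * (1 - r\<^sup>2))"
    "D $ 2 $ 1 = - r / (s1 * s2 * (1 - r\<^sup>2))" "D $ 2 $ 2 = 1 / (s2\<^sup>2 * (1 - r\<^sup>2))"
    by (simp_all add: D_def vector_2)
  have CD: "C ** D = mat 1" "D ** C = mat 1"
  proof -
    \<comment> \<open>A generic nonzero \<open>t\<close> replaces 1 - r^2, so that simplification
      treats this factor as an atom.\<close>
    have diag: "s1\<^sup>2 * (1 / (s1\<^sup>2 * t)) + r * s1 * s2 * (- r / (s1 * s2 * t)) = (1 - r\<^sup>2) / t"
      "r * s1 * s2 * (- r / (s1 * s2 * t)) + s2\<^sup>2 * (1 / (s2\<^sup>2 * t)) = (1 - r\<^sup>2) / t"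
      and off: "s1\<^sup>2 * (- r / (s1 * s2 * t)) + r * s1 * s2 * (1 / (s2\<^sup>2 * t)) = 0"
      "r * s1 * s2 * (1 / (s1\<^sup>2 * t)) + s2\<^sup>2 * (- r / (s1 * s2 * t)) = 0" if "t \<noteq> 0" for t
      using p(1,2) that by (simp_all add: field_simps power2_eq_square)
    have t: "1 - r\<^sup>2 \<noteq> 0" using r1 by simp
    show "C ** D = mat 1"
      unfolding vec_eq_iff forall_2 matrix_matrix_mult_def sum_2 vec_lambda_beta D p(6-9) diag[OF t] off[OF t]
      using t by (simp add: mat_def)
    then show "D ** C = mat 1"
      by (simp add: matrix_left_right_inverse)
  qed
  have inv: "matrix_inv C = D"
    by (rule matrix_inv_eqI[OF CD])
  have "det C = (s1 * s2)\<^sup>2 * (1 - r\<^sup>2)"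
    by (simp add: det_2 p(6-9) power2_eq_square algebra_simps)
  then have det: "sqrt (det C) = s1 * s2 * resid_sd \<theta>"
    using p(1,2) by (simp add: real_sqrt_mult resid_sd_def r_def)
  define y where "y = x - m"
  have uv: "u x = y $ 1 / s1" "v x = y $ 2 / s2"
    by (simp_all add: u_def v_def y_def s1_def s2_def \<theta>)
  have quad: "a * (1 / (s1\<^sup>2 * t) * a + - r / (s1 * s2 * t) * b) + b * (- r / (s1 * s2 * t) * a + 1 / (s2\<^sup>2 * t) * b) =
      ((a / s1)\<^sup>2 - 2 * r * (a / s1) * (b / s2) + (b / s2)\<^sup>2) / t" if "t \<noteq> 0" for a b t
    using p(1,2) that by (simp add: field_simps power2_eq_square)
  have "y \<bullet> (D *v y) = ((u x)\<^sup>2 - 2 * r * u x * v x + (v x)\<^sup>2) / (1 - r\<^sup>2)"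
    using r1 unfolding uv inner_vec_def matrix_vector_mult_def sum_2 vec_lambda_beta D inner_real_def
    by (intro quad) simp
  then have "- (y \<bullet> (D *v y)) / 2 = - ((u x)\<^sup>2 - 2 * r * u x * v x + (v x)\<^sup>2) / (2 * (1 - r\<^sup>2))"
    by (simp only: minus_divide_left divide_divide_eq_left mult.commute[of 2])
  then show ?thesis
    by (simp add: gauss_density_def \<theta> inv y_def[symmetric] det[unfolded \<theta>] s1_def[unfolded \<theta>] s2_def[unfolded \<theta>])
qed

text \<open>The affine map given by the mean and the lower triangular Cholesky factor of the
  covariance. Its second coordinate is the regression on the first plus an independent residual when
  \<open>p\<close> has independent standard normal coordinates.\<close>

definition chol :: "param \<Rightarrow> real \<times> real \<Rightarrow> real^2" where
  "chol \<theta> p = vector [fst \<theta> $ 1 + sd 1 \<theta> * fst p,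
     fst \<theta> $ 2 + sd 2 \<theta> * corr \<theta> * fst p + sd 2 \<theta> * resid_sd \<theta> * snd p]"

lemma chol_nth [simp]:
  "chol \<theta> p $ 1 = fst \<theta> $ 1 + sd 1 \<theta> * fst p"
  "chol \<theta> p $ 2 = fst \<theta> $ 2 + sd 2 \<theta> * corr \<theta> * fst p + sd 2 \<theta> * resid_sd \<theta> * snd p"
  by (simp_all add: chol_def vector_2)

lemma borel_measurable_chol [measurable]: "chol \<theta> \<in> borel_measurable (std_gauss \<Otimes>\<^sub>M std_gauss)"
  unfolding chol_def by measurable

text \<open>In these coordinates the exponent is the squared Euclidean norm, and sd 1 * sd 2 *
  resid_sd is the Jacobian of \<open>chol\<close>. The first claim serves the change of variables,
  the second the log likelihood.\<close>

lemma gauss_density_chol: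
  assumes "\<theta> \<in> Theta"
  shows "sd 1 \<theta> * sd 2 \<theta> * resid_sd \<theta> * gauss_density \<theta> (chol \<theta> p) =
    std_normal_density (fst p) * std_normal_density (snd p)"
    and "ln (gauss_density \<theta> (chol \<theta> p)) =
      - ((fst p)\<^sup>2 + (snd p)\<^sup>2) / 2 - ln (2 * pi * (sd 1 \<theta> * sd 2 \<theta> * resid_sd \<theta>))"
proof -
  note q = Theta_params[OF assms]
  obtain a b where p: "p = (a, b)" by (cases p)
  define r w where "r = corr \<theta>" and "w = resid_sd \<theta>"
  have r1: "0 < 1 - r\<^sup>2" using q(3) by (simp add: abs_square_less_1 r_def)
  have w: "w\<^sup>2 = 1 - r\<^sup>2" using q by (simp add: r_def w_def)
  have "a\<^sup>2 - 2 * r * a * (r * a + w * b) + (r * a + w * b)\<^sup>2 = (1 - r\<^sup>2) * a\<^sup>2 + w\<^sup>2 * b\<^sup>2"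
    by (simp add: power2_eq_square algebra_simps)
  also have "\<dots> = (a\<^sup>2 + b\<^sup>2) * (1 - r\<^sup>2)" by (simp add: w algebra_simps)
  finally have eq: "a\<^sup>2 - 2 * r * a * (r * a + w * b) + (r * a + w * b)\<^sup>2 = (a\<^sup>2 + b\<^sup>2) * (1 - r\<^sup>2)" .
  have "- (X * k) / (2 * k) = - X / 2" if "k \<noteq> 0" for X k :: real
    using that by simp
  with r1 have "- (a\<^sup>2 - 2 * r * a * (r * a + w * b) + (r * a + w * b)\<^sup>2) / (2 * (1 - r\<^sup>2)) = - (a\<^sup>2 + b\<^sup>2) / 2"
    unfolding eq by (metis less_irrefl)
  moreover have "(chol \<theta> p $ 1 - fst \<theta> $ 1) / sd 1 \<theta> = a" "(chol \<theta> p $ 2 - fst \<theta> $ 2) / sd 2 \<theta> = r * a + w * b"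
    using q by (simp_all add: p r_def w_def add_divide_distrib)
  ultimately have d: "gauss_density \<theta> (chol \<theta> p) = exp (- (a\<^sup>2 + b\<^sup>2) / 2) / (2 * pi * (sd 1 \<theta> * sd 2 \<theta> * resid_sd \<theta>))"
    unfolding gauss_density_eq[OF assms] by (simp only: r_def[symmetric])
  have "exp (- (a\<^sup>2 + b\<^sup>2) / 2) = exp (- a\<^sup>2 / 2) * exp (- b\<^sup>2 / 2)"
    by (simp add: exp_add[symmetric] add_divide_distrib)
  then show "sd 1 \<theta> * sd 2 \<theta> * resid_sd \<theta> * gauss_density \<theta> (chol \<theta> p) =
    std_normal_density (fst p) * std_normal_density (snd p)"
    using q unfolding d by (simp add: p std_normal_density_def field_simps)
  show "ln (gauss_density \<theta> (chol \<theta> p)) =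
      - ((fst p)\<^sup>2 + (snd p)\<^sup>2) / 2 - ln (2 * pi * (sd 1 \<theta> * sd 2 \<theta> * resid_sd \<theta>))"
    using q unfolding d by (simp add: p ln_div)
qed

lemma gauss_density_pos:
  assumes "\<theta> \<in> Theta"
  shows "0 < gauss_density \<theta> x"
  using Theta_params[OF assms] unfolding gauss_density_eq[OF assms] by simp

lemma borel_measurable_gauss_density [measurable]: 
  assumes "\<theta> \<in> Theta"
  shows "gauss_density \<theta> \<in> borel_measurable borel"
  unfolding gauss_density_eq[OF assms] by measurable

text \<open>The two measures agree on boxes, which determines Lebesgue measure; Tonelli and
  one-dimensional substitution become available on \<open>real^2\<close>.\<close>

lemma lborel_vector_2:
  "(lborel :: (real^2) measure) = distr (lborel \<Otimes>\<^sub>M lborel) borel (\<lambda>p. vector [fst p, snd p])"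
proof (rule lborel_eqI)
  fix l u :: "real^2" assume lu: "\<And>b. b \<in> Basis \<Longrightarrow> l \<bullet> b \<le> u \<bullet> b"
  have "axis j 1 \<in> (Basis :: (real^2) set)" for j :: 2
    by (auto simp: Basis_vec_def)
  from lu[OF this] have lu': "l $ j \<le> u $ j" for j :: 2
    by (simp add: inner_axis)
  have "(\<lambda>p. vector [fst p, snd p]) -` box l u = {l $ 1<..<u $ 1} \<times> {l $ 2<..<u $ 2}"
    by (auto simp: mem_box_cart forall_2 vector_2)
  then have "emeasure (distr (lborel \<Otimes>\<^sub>M lborel) borel (\<lambda>p. vector [fst p, snd p])) (box l u) =
      emeasure (lborel \<Otimes>\<^sub>M lborel) ({l $ 1<..<u $ 1} \<times> {l $ 2<..<u $ 2})"
    by (subst emeasure_distr) (auto simp: space_pair_measure)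
  also have "\<dots> = ennreal (u $ 1 - l $ 1) * ennreal (u $ 2 - l $ 2)"
    using lu' by (subst lborel.emeasure_pair_measure_Times) auto
  also have "\<dots> = ennreal (\<Prod>b\<in>Basis. (u - l) \<bullet> b)"
    using lu' by (simp add: Basis_vec_def UNIV_2 axis_eq_axis inner_axis ennreal_mult'[symmetric])
  finally show "emeasure (distr (lborel \<Otimes>\<^sub>M lborel) borel (\<lambda>p. vector [fst p, snd p])) (box l u) =
    ennreal (\<Prod>b\<in>Basis. (u - l) \<bullet> b)" .
qed simp

text \<open>Since \<open>chol\<close> is triangular, the two-dimensional substitution splits into
  two affine ones on the line: first in the first coordinate, then in the second with a shift
  depending on the first.\<close>

lemma gauss_law_eq_distr:
  assumes "\<theta> \<in> Theta"
  shows "gauss_law \<theta> = distr (std_gauss \<Otimes>\<^sub>M std_gauss) borel (chol \<theta>)"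
proof (rule measure_eqI)
  note q = Theta_params[OF assms]
  note [measurable] = borel_measurable_gauss_density[OF assms]
  fix A assume "A \<in> sets (gauss_law \<theta>)"
  then have A [measurable]: "A \<in> sets borel" by (simp add: gauss_law_def)
  define F where "F x = ennreal (gauss_density \<theta> x) * indicator A x" for x
  have F [measurable]: "F \<in> borel_measurable borel" unfolding F_def by measurable
  have "emeasure (gauss_law \<theta>) A = (\<integral>\<^sup>+ x. F x \<partial>lborel)"
    by (simp add: gauss_law_def emeasure_density F_def)
  also have "\<dots> = (\<integral>\<^sup>+ p. F (vector [fst p, snd p]) \<partial>(lborel \<Otimes>\<^sub>M lborel))"
    by (subst lborel_vector_2) (simp add: nn_integral_distr)
  also have "\<dots> = (\<integral>\<^sup>+ x. \<integral>\<^sup>+ y. F (vector [x, y]) \<partial>lborel \<partial>lborel)"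
    by (subst lborel.nn_integral_fst[symmetric]) auto
  also have "\<dots> = sd 1 \<theta> * (\<integral>\<^sup>+ a. \<integral>\<^sup>+ y. F (vector [fst \<theta> $ 1 + sd 1 \<theta> * a, y]) \<partial>lborel \<partial>lborel)"
    using q by (subst nn_integral_real_affine[where c = "sd 1 \<theta>" and t = "fst \<theta> $ 1"]) auto
  also have "(\<integral>\<^sup>+ a. \<integral>\<^sup>+ y. F (vector [fst \<theta> $ 1 + sd 1 \<theta> * a, y]) \<partial>lborel \<partial>lborel) =
      (\<integral>\<^sup>+ a. ennreal (sd 2 \<theta> * resid_sd \<theta>) * (\<integral>\<^sup>+ b. F (chol \<theta> (a, b)) \<partial>lborel) \<partial>lborel)"
    using q unfolding chol_def
    by (intro nn_integral_cong, subst nn_integral_real_affine[where c = "sd 2 \<theta> * resid_sd \<theta>" and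
      t = "fst \<theta> $ 2 + sd 2 \<theta> * corr \<theta> * a" for a]) auto
  also have "ennreal (sd 1 \<theta>) * \<dots> =
      (\<integral>\<^sup>+ a. \<integral>\<^sup>+ b. ennreal (sd 1 \<theta> * sd 2 \<theta> * resid_sd \<theta>) * F (chol \<theta> (a, b)) \<partial>lborel \<partial>lborel)"
    using q unfolding chol_def
    by (simp add: nn_integral_cmult ennreal_mult' mult.assoc)
  also have "\<dots> = (\<integral>\<^sup>+ a. ennreal (std_normal_density a) * (\<integral>\<^sup>+ b. ennreal (std_normal_density b) *
      indicator A (chol \<theta> (a, b)) \<partial>lborel) \<partial>lborel)"
  proof (intro nn_integral_cong)
    fix a :: real
    have "ennreal (sd 1 \<theta> * sd 2 \<theta> * resid_sd \<theta>) * F (chol \<theta> (a, b)) =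
      ennreal (std_normal_density a) * (ennreal (std_normal_density b) * indicator A (chol \<theta> (a, b)))" for b
      using q gauss_density_chol(1)[OF assms, of "(a, b)"]
      by (simp add: F_def mult.assoc[symmetric] ennreal_mult'[symmetric])
    then show "(\<integral>\<^sup>+ b. ennreal (sd 1 \<theta> * sd 2 \<theta> * resid_sd \<theta>) * F (chol \<theta> (a, b)) \<partial>lborel) =
      ennreal (std_normal_density a) * (\<integral>\<^sup>+ b. ennreal (std_normal_density b) * indicator A (chol \<theta> (a, b)) \<partial>lborel)"
      unfolding chol_def by (simp add: nn_integral_cmult)
  qed
  also have "\<dots> = (\<integral>\<^sup>+ a. \<integral>\<^sup>+ b. indicator A (chol \<theta> (a, b)) \<partial>std_gauss \<partial>std_gauss)"
    unfolding chol_def by (simp add: nn_integral_density)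
  also have "\<dots> = (\<integral>\<^sup>+ p. indicator A (chol \<theta> p) \<partial>(std_gauss \<Otimes>\<^sub>M std_gauss))"
    by (subst std_gauss.nn_integral_fst[symmetric]) auto
  also have "\<dots> = (\<integral>\<^sup>+ x. indicator A x \<partial>distr (std_gauss \<Otimes>\<^sub>M std_gauss) borel (chol \<theta>))"
    by (subst nn_integral_distr) auto
  also have "\<dots> = emeasure (distr (std_gauss \<Otimes>\<^sub>M std_gauss) borel (chol \<theta>)) A"
    by simp
  finally show "emeasure (gauss_law \<theta>) A = emeasure (distr (std_gauss \<Otimes>\<^sub>M std_gauss) borel (chol \<theta>)) A" .
qed (simp add: gauss_law_def)

lemma prob_space_gauss_law:
  assumes "\<theta> \<in> Theta"
  shows "prob_space (gauss_law \<theta>)"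
proof -
  interpret pair_prob_space std_gauss std_gauss ..
  show ?thesis unfolding gauss_law_eq_distr[OF assms] by (rule prob_space_distr) simp
qed

section \<open>Moments and Kullback--Leibler information\<close>

lemma std_gauss_moments:
  "integrable std_gauss (\<lambda>x. x ^ k)" "(\<integral>x. x \<partial>std_gauss) = 0" "(\<integral>x. x\<^sup>2 \<partial>std_gauss) = 1"
  using integrable_std_normal_moment[of k] integral_std_normal_moment_odd[of 0] integral_std_normal_moment_even[of 1]
  by (simp_all add: integrable_density integral_density)

lemma std_gauss_pair_mult:
  fixes g k :: "real \<Rightarrow> real"
  assumes g: "integrable std_gauss g" and k: "integrable std_gauss k"
  shows "integrable (std_gauss \<Otimes>\<^sub>M std_gauss) (\<lambda>p. g (fst p) * k (snd p))"
    and "(\<integral>p. g (fst p) * k (snd p) \<partial>(std_gauss \<Otimes>\<^sub>M std_gauss)) = (\<integral>x. g x \<partial>std_gauss) * (\<integral>x. k x \<partial>std_gauss)"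
proof -
  interpret pair_prob_space std_gauss std_gauss ..
  have [measurable]: "g \<in> borel_measurable std_gauss" "k \<in> borel_measurable std_gauss"
    using g k by auto
  show int: "integrable (std_gauss \<Otimes>\<^sub>M std_gauss) (\<lambda>p. g (fst p) * k (snd p))"
    by (rule Fubini_integrable) (use g k in \<open>auto simp: abs_mult\<close>)
  show "(\<integral>p. g (fst p) * k (snd p) \<partial>(std_gauss \<Otimes>\<^sub>M std_gauss)) = (\<integral>x. g x \<partial>std_gauss) * (\<integral>x. k x \<partial>std_gauss)"
    using integral_fst'[OF int] g k by simp
qed

lemma std_gauss_pair_monom:
  "integrable (std_gauss \<Otimes>\<^sub>M std_gauss) (\<lambda>p. fst p ^ i * snd p ^ j)"
  "(\<integral>p. fst p ^ i * snd p ^ j \<partial>(std_gauss \<Otimes>\<^sub>M std_gauss)) = (\<integral>x. x ^ i \<partial>std_gauss) * (\<integral>x. x ^ j \<partial>std_gauss)"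
  using std_gauss_pair_mult[OF std_gauss_moments(1)[of i] std_gauss_moments(1)[of j]] by auto

text \<open>All functions averaged below are of degree at most two in the underlying normals. Odd
  and mixed moments vanish and second moments are 1, so the mean is read off the coefficients;
  fourth moments give square integrability.\<close>

lemma gauss_law_quadratic:
  assumes \<theta>: "\<theta> \<in> Theta" and h [measurable]: "h \<in> borel_measurable borel"
    and quad: "\<And>a b. h (chol \<theta> (a, b)) = c0 + c1 * a + c2 * b + c3 * a\<^sup>2 + c4 * (a * b) + c5 * b\<^sup>2"
  shows "integrable (gauss_law \<theta>) (\<lambda>x. (h x)\<^sup>2)" and "(\<integral>x. h x \<partial>gauss_law \<theta>) = c0 + c3 + c5"
proof -
  let ?P = "std_gauss \<Otimes>\<^sub>M std_gauss"
  interpret pair_prob_space std_gauss std_gauss ..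
  note mono = std_gauss_pair_monom(1)
  define K where "K = \<bar>c0\<bar> + \<bar>c1\<bar> + \<bar>c2\<bar> + \<bar>c3\<bar> + \<bar>c4\<bar> + \<bar>c5\<bar>"
  \<comment> \<open>Each monomial is at most q = 1 + a^2 + b^2 in absolute value, hence |h| \<le> K
    q, and q^2 \<le> 3 (1 + a^4 + b^4).\<close>
  have bound: "(h (chol \<theta> p))\<^sup>2 \<le> 3 * K\<^sup>2 * (1 + fst p ^ 4 * snd p ^ 0 + fst p ^ 0 * snd p ^ 4)" for p
  proof -
    obtain a b where p: "p = (a, b)" by (cases p)
    define q where "q = 1 + a\<^sup>2 + b\<^sup>2"
    have a: "\<bar>a\<bar> \<le> q" using zero_le_power2[of "\<bar>a\<bar> - 1"] zero_le_power2[of b]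
      by (simp add: q_def power2_diff) (smt (verit) zero_le_power2)
    have b: "\<bar>b\<bar> \<le> q" using zero_le_power2[of "\<bar>b\<bar> - 1"] zero_le_power2[of a]
      by (simp add: q_def power2_diff) (smt (verit) zero_le_power2)
    have "0 \<le> \<bar>a\<bar> * \<bar>b\<bar>" by simp
    moreover have "2 * (\<bar>a\<bar> * \<bar>b\<bar>) \<le> a\<^sup>2 + b\<^sup>2"
      using zero_le_power2[of "\<bar>a\<bar> - \<bar>b\<bar>"] by (simp add: power2_diff)
    ultimately have "\<bar>a * b\<bar> \<le> a\<^sup>2 + b\<^sup>2"
      unfolding abs_mult by linarith
    then have ab: "\<bar>a * b\<bar> \<le> q" unfolding q_def by simp
    have sq: "\<bar>1 :: real\<bar> \<le> q" "\<bar>a\<^sup>2\<bar> \<le> q" "\<bar>b\<^sup>2\<bar> \<le> q" by (auto simp: q_def)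
    have "\<bar>h (chol \<theta> p)\<bar> \<le> \<bar>c0 * 1\<bar> + \<bar>c1 * a\<bar> + \<bar>c2 * b\<bar> + \<bar>c3 * a\<^sup>2\<bar> + \<bar>c4 * (a * b)\<bar> + \<bar>c5 * b\<^sup>2\<bar>"
      unfolding p quad by linarith
    also have "\<dots> \<le> \<bar>c0\<bar> * q + \<bar>c1\<bar> * q + \<bar>c2\<bar> * q + \<bar>c3\<bar> * q + \<bar>c4\<bar> * q + \<bar>c5\<bar> * q"
      unfolding abs_mult[of c0] abs_mult[of c1] abs_mult[of c2] abs_mult[of c3] abs_mult[of c4] abs_mult[of c5]
      by (intro add_mono mult_left_mono a b ab sq abs_ge_zero)
    also have "\<dots> = K * q" by (simp add: K_def algebra_simps)
    finally have "(h (chol \<theta> p))\<^sup>2 \<le> (K * q)\<^sup>2"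
      using power_mono[of "\<bar>h (chol \<theta> p)\<bar>" "K * q" 2] by simp
    also have "\<dots> = K\<^sup>2 * q\<^sup>2" by (simp add: power_mult_distrib)
    also have "K\<^sup>2 * q\<^sup>2 \<le> K\<^sup>2 * (3 * (1 + a ^ 4 + b ^ 4))"
    proof (rule mult_left_mono)
      have "a ^ 4 = (a\<^sup>2)\<^sup>2" "b ^ 4 = (b\<^sup>2)\<^sup>2" by (simp_all flip: power_mult)
      then show "q\<^sup>2 \<le> 3 * (1 + a ^ 4 + b ^ 4)"
        using zero_le_power2[of "a\<^sup>2 - b\<^sup>2"] zero_le_power2[of "a\<^sup>2 - 1"] zero_le_power2[of "b\<^sup>2 - 1"]
        by (simp add: q_def power2_eq_square algebra_simps)
    qed simp
    finally show ?thesis by (simp add: p algebra_simps)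
  qed
  have "integrable ?P (\<lambda>p. 3 * K\<^sup>2 * (1 + fst p ^ 4 * snd p ^ 0 + fst p ^ 0 * snd p ^ 4))"
    using mono[of 4 0] mono[of 0 4] by (intro Bochner_Integration.integrable_mult_right Bochner_Integration.integrable_add) auto
  then have "integrable ?P (\<lambda>p. (h (chol \<theta> p))\<^sup>2)"
    by (rule Bochner_Integration.integrable_bound) (use bound in \<open>auto intro: order_trans[OF bound abs_ge_self]\<close>)
  then show "integrable (gauss_law \<theta>) (\<lambda>x. (h x)\<^sup>2)"
    unfolding gauss_law_eq_distr[OF \<theta>] by (subst integrable_distr_eq) auto
  have "(\<integral>x. h x \<partial>gauss_law \<theta>) = (\<integral>p. h (chol \<theta> p) \<partial>?P)"
    unfolding gauss_law_eq_distr[OF \<theta>] by (subst integral_distr) auto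
  also have "\<dots> = (\<integral>p. c0 * (fst p ^ 0 * snd p ^ 0) + c1 * (fst p ^ 1 * snd p ^ 0) + c2 * (fst p ^ 0 * snd p ^ 1) +
      c3 * (fst p ^ 2 * snd p ^ 0) + c4 * (fst p ^ 1 * snd p ^ 1) + c5 * (fst p ^ 0 * snd p ^ 2) \<partial>?P)"
    using quad by (intro Bochner_Integration.integral_cong) (auto simp: split_paired_all)
  also have "\<dots> = c0 + c3 + c5"
    by (simp only: Bochner_Integration.integral_add Bochner_Integration.integrable_add
        Bochner_Integration.integrable_mult_right mono integral_mult_right_zero std_gauss_pair_monom(2))
      (simp add: std_gauss_moments std_gauss.prob_space[simplified])
  finally show "(\<integral>x. h x \<partial>gauss_law \<theta>) = c0 + c3 + c5" .
qed

lemma corr_coeff_tendsto: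
  assumes lim: "(\<lambda>n. (\<Sum>i=1..n. x i) / real n) \<longlonglongrightarrow> ex" "(\<lambda>n. (\<Sum>i=1..n. y i) / real n) \<longlonglongrightarrow> ey"
    "(\<lambda>n. (\<Sum>i=1..n. x i * x i) / real n) \<longlonglongrightarrow> exx" "(\<lambda>n. (\<Sum>i=1..n. y i * y i) / real n) \<longlonglongrightarrow> eyy"
    "(\<lambda>n. (\<Sum>i=1..n. x i * y i) / real n) \<longlonglongrightarrow> exy"
    and pos: "0 < exx - ex * ex" "0 < eyy - ey * ey"
  shows "(\<lambda>n. corr_coeff n x y) \<longlonglongrightarrow> (exy - ex * ey) / sqrt ((exx - ex * ex) * (eyy - ey * ey))"
proof -
  have cd: "(\<lambda>n. cross_dev n u w / real n) \<longlonglongrightarrow> euw - eu * ew"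
    if "(\<lambda>n. (\<Sum>i=1..n. u i) / real n) \<longlonglongrightarrow> eu" "(\<lambda>n. (\<Sum>i=1..n. w i) / real n) \<longlonglongrightarrow> ew"
      "(\<lambda>n. (\<Sum>i=1..n. u i * w i) / real n) \<longlonglongrightarrow> euw" for u w eu ew euw
    using tendsto_diff[OF that(3) tendsto_mult[OF that(1,2)]]
    by (simp add: cross_dev_eq diff_divide_distrib)
  have "(\<lambda>n. (cross_dev n x y / real n) / sqrt ((cross_dev n x x / real n) * (cross_dev n y y / real n)))
      \<longlonglongrightarrow> (exy - ex * ey) / sqrt ((exx - ex * ex) * (eyy - ey * ey))"
    using pos by (intro tendsto_divide tendsto_real_sqrt tendsto_mult cd lim) auto
  moreover have "\<forall>\<^sub>F n in sequentially. (cross_dev n x y / real n) /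
      sqrt ((cross_dev n x x / real n) * (cross_dev n y y / real n)) = corr_coeff n x y"
    using eventually_gt_at_top[of 0]
  proof eventually_elim
    case (elim n)
    have "sqrt ((cross_dev n x x / real n) * (cross_dev n y y / real n)) =
        sqrt (cross_dev n x x * cross_dev n y y) / real n"
      using elim by (simp add: real_sqrt_divide)
    then show ?case using elim by (simp add: corr_coeff_def)
  qed
  ultimately show ?thesis by (rule Lim_transform_eventually)
qed

text \<open>The null density is in the numerator, so the mean under \<theta> is minus the
  Kullback-Leibler information.\<close>

definition log_ratio :: "param \<Rightarrow> param \<Rightarrow> real^2 \<Rightarrow> real" where
  "log_ratio \<theta> \<theta>0 x = ln (gauss_density \<theta>0 x / gauss_density \<theta> x)"

lemma borel_measurable_log_ratio:
  "\<theta> \<in> Theta \<Longrightarrow> \<theta>0 \<in> Theta \<Longrightarrow> log_ratio \<theta> \<theta>0 \<in> borel_measurable borel"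
  unfolding log_ratio_def using borel_measurable_gauss_density by measurable

text \<open>In Cholesky coordinates the log ratio is a quadratic polynomial, the form required by
  \<open>gauss_law_quadratic\<close> both for its mean and for its square integrability.\<close>

lemma log_ratio_chol:
  assumes \<theta>: "\<theta> \<in> Theta" and \<theta>0: "\<theta>0 \<in> Theta0"
  defines "u \<equiv> \<lambda>a. (fst \<theta> $ 1 + sd 1 \<theta> * a - fst \<theta>0 $ 1) / sd 1 \<theta>0"
    and "v \<equiv> \<lambda>a b. (fst \<theta> $ 2 + sd 2 \<theta> * corr \<theta> * a + sd 2 \<theta> * resid_sd \<theta> * b - fst \<theta>0 $ 2) / sd 2 \<theta>0"
  shows "log_ratio \<theta> \<theta>0 (chol \<theta> (a, b)) = (a\<^sup>2 + b\<^sup>2) / 2 - ((u a)\<^sup>2 + (v a b)\<^sup>2) / 2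
    + ln (sd 1 \<theta> * sd 2 \<theta> * resid_sd \<theta> / (sd 1 \<theta>0 * sd 2 \<theta>0))"
proof -
  have \<theta>0': "\<theta>0 \<in> Theta" "corr \<theta>0 = 0" using \<theta>0 by (auto simp: Theta0_def)
  note p = Theta_params(1,2,4)[OF \<theta>] and p0 = Theta_params(1,2)[OF \<theta>0'(1)]
  have "log_ratio \<theta> \<theta>0 (chol \<theta> (a, b)) = ln (gauss_density \<theta>0 (chol \<theta> (a, b))) - ln (gauss_density \<theta> (chol \<theta> (a, b)))"
    unfolding log_ratio_def using gauss_density_pos[OF \<theta>] gauss_density_pos[OF \<theta>0'(1)] by (simp add: ln_divide_pos)
  also have "ln (gauss_density \<theta>0 (chol \<theta> (a, b))) = - ((u a)\<^sup>2 + (v a b)\<^sup>2) / 2 - ln (2 * pi * (sd 1 \<theta>0 * sd 2 \<theta>0))"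
    unfolding gauss_density_eq[OF \<theta>0'(1)] using p0
    by (simp add: ln_divide_pos \<theta>0'(2) u_def v_def resid_sd_def)
  also have "ln (gauss_density \<theta> (chol \<theta> (a, b))) = - (a\<^sup>2 + b\<^sup>2) / 2 - ln (2 * pi * (sd 1 \<theta> * sd 2 \<theta> * resid_sd \<theta>))"
    using gauss_density_chol(2)[OF \<theta>, of "(a, b)"] by simp
  also have "ln (2 * pi * (sd 1 \<theta> * sd 2 \<theta> * resid_sd \<theta>)) = ln (2 * pi) + ln (sd 1 \<theta> * sd 2 \<theta> * resid_sd \<theta>)"
    using p by (intro ln_mult_pos) auto
  also have "ln (2 * pi * (sd 1 \<theta>0 * sd 2 \<theta>0)) = ln (2 * pi) + ln (sd 1 \<theta>0 * sd 2 \<theta>0)"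
    using p0 by (intro ln_mult_pos) auto
  also have "- ((u a)\<^sup>2 + (v a b)\<^sup>2) / 2 - (ln (2 * pi) + ln (sd 1 \<theta>0 * sd 2 \<theta>0)) -
    (- (a\<^sup>2 + b\<^sup>2) / 2 - (ln (2 * pi) + ln (sd 1 \<theta> * sd 2 \<theta> * resid_sd \<theta>))) =
    (a\<^sup>2 + b\<^sup>2) / 2 - ((u a)\<^sup>2 + (v a b)\<^sup>2) / 2 + (ln (sd 1 \<theta> * sd 2 \<theta> * resid_sd \<theta>) - ln (sd 1 \<theta>0 * sd 2 \<theta>0))"
    by (simp add: field_simps)
  also have "ln (sd 1 \<theta> * sd 2 \<theta> * resid_sd \<theta>) - ln (sd 1 \<theta>0 * sd 2 \<theta>0) = ln (sd 1 \<theta> * sd 2 \<theta> * resid_sd \<theta> / (sd 1 \<theta>0 * sd 2 \<theta>0))"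
    using p p0 by (simp add: ln_divide_pos)
  finally show ?thesis .
qed

lemma integrable_log_ratio_square:
  assumes \<theta>: "\<theta> \<in> Theta" and \<theta>0: "\<theta>0 \<in> Theta0"
  shows "integrable (gauss_law \<theta>) (\<lambda>x. (log_ratio \<theta> \<theta>0 x)\<^sup>2)"
proof -
  have [measurable]: "log_ratio \<theta> \<theta>0 \<in> borel_measurable borel"
    using assms by (intro borel_measurable_log_ratio) (auto simp: Theta0_def)
  define L where "L = ln (sd 1 \<theta> * sd 2 \<theta> * resid_sd \<theta> / (sd 1 \<theta>0 * sd 2 \<theta>0))"
  define p q where "p = (fst \<theta> $ 1 - fst \<theta>0 $ 1) / sd 1 \<theta>0" and "q = sd 1 \<theta> / sd 1 \<theta>0"
  define p' q' w where "p' = (fst \<theta> $ 2 - fst \<theta>0 $ 2) / sd 2 \<theta>0" and "q' = sd 2 \<theta> * corr \<theta> / sd 2 \<theta>0"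
    and "w = sd 2 \<theta> * resid_sd \<theta> / sd 2 \<theta>0"
  have "(fst \<theta> $ 1 + sd 1 \<theta> * a - fst \<theta>0 $ 1) / sd 1 \<theta>0 = p + q * a"
    "(fst \<theta> $ 2 + sd 2 \<theta> * corr \<theta> * a + sd 2 \<theta> * resid_sd \<theta> * b - fst \<theta>0 $ 2) / sd 2 \<theta>0 = p' + q' * a + w * b" for a b
    by (simp_all add: p_def q_def p'_def q'_def w_def add_divide_distrib diff_divide_distrib)
  then have "log_ratio \<theta> \<theta>0 (chol \<theta> (a, b)) =
      (a\<^sup>2 + b\<^sup>2) / 2 - ((p + q * a)\<^sup>2 + (p' + q' * a + w * b)\<^sup>2) / 2 + L" for a b
    unfolding log_ratio_chol[OF assms] L_def by simp
  moreover have "(a\<^sup>2 + b\<^sup>2) / 2 - ((p + q * a)\<^sup>2 + (p' + q' * a + w * b)\<^sup>2) / 2 + L =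
      (L - (p\<^sup>2 + p'\<^sup>2) / 2) + (- p * q - p' * q') * a + (- p' * w) * b + (1 - q\<^sup>2 - q'\<^sup>2) / 2 * a\<^sup>2 + (- q' * w) * (a * b)
      + (1 - w\<^sup>2) / 2 * b\<^sup>2" for a b
    by (simp add: power2_eq_square field_simps)
  ultimately have "log_ratio \<theta> \<theta>0 (chol \<theta> (a, b)) =
      (L - (p\<^sup>2 + p'\<^sup>2) / 2) + (- p * q - p' * q') * a + (- p' * w) * b + (1 - q\<^sup>2 - q'\<^sup>2) / 2 * a\<^sup>2 + (- q' * w) * (a * b)
      + (1 - w\<^sup>2) / 2 * b\<^sup>2" for a b
    by (simp only:)
  then show ?thesis
    by (rule gauss_law_quadratic(1)[OF \<theta>, rotated]) measurable
qed

lemma integral_log_ratio: "(\<integral>x. log_ratio \<theta> \<theta>0 x \<partial>gauss_law \<theta>) = - KL_info \<theta> \<theta>0"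
  by (simp add: KL_info_def log_ratio_def)

text \<open>The null parameter with the same two marginals as \<theta>; its divergence from \<theta>
  is the mutual information of the coordinates.\<close>

definition proj0 :: "param \<Rightarrow> param" where
  "proj0 \<theta> = (fst \<theta>, \<chi> i j. if i = j then snd \<theta> $ i $ j else 0)"

lemma proj0_params: "fst (proj0 \<theta>) = fst \<theta>" "sd j (proj0 \<theta>) = sd j \<theta>" "corr (proj0 \<theta>) = 0"
  by (auto simp: proj0_def sd_def corr_def)

lemma proj0_in_Theta0:
  assumes "\<theta> \<in> Theta"
  shows "proj0 \<theta> \<in> Theta0"
proof -
  have "0 < v \<bullet> (snd (proj0 \<theta>) *v v)" if "v \<noteq> 0" for v
  proof -
    have eq: "v \<bullet> (snd (proj0 \<theta>) *v v) = snd \<theta> $ 1 $ 1 * (v $ 1)\<^sup>2 + snd \<theta> $ 2 $ 2 * (v $ 2)\<^sup>2"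
      by (simp add: proj0_def inner_vec_def matrix_vector_mult_def sum_2 power2_eq_square)
    have "v $ 1 \<noteq> 0 \<or> v $ 2 \<noteq> 0" using that by (auto simp: vec_eq_iff forall_2)
    then show ?thesis
      unfolding eq using ThetaD(2,3)[OF assms] by (auto intro: add_pos_nonneg add_nonneg_pos)
  qed
  moreover have "transpose (snd (proj0 \<theta>)) = snd (proj0 \<theta>)"
    by (auto simp: proj0_def transpose_def vec_eq_iff)
  ultimately have "proj0 \<theta> \<in> Theta"
    unfolding Theta_def by (auto simp: split_beta)
  then show ?thesis by (simp add: Theta0_def proj0_params)
qed

text \<open>The coefficients of a^2 and b^2 in the log ratio, -r^2 / 2 and (1 - w^2) / 2, add up to
  0 because w^2 = 1 - r^2; only the constant \<open>ln w\<close> survives.\<close>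

lemma KL_info_proj0:
  assumes \<theta>: "\<theta> \<in> Theta"
  shows "KL_info \<theta> (proj0 \<theta>) = - ln (1 - (corr \<theta>)\<^sup>2) / 2"
proof -
  note p = Theta_params[OF \<theta>]
  have \<theta>0: "proj0 \<theta> \<in> Theta0" by (rule proj0_in_Theta0[OF \<theta>])
  have [measurable]: "log_ratio \<theta> (proj0 \<theta>) \<in> borel_measurable borel"
    using \<theta> \<theta>0 by (intro borel_measurable_log_ratio) (auto simp: Theta0_def)
  define r w where "r = corr \<theta>" and "w = resid_sd \<theta>"
  have w: "w\<^sup>2 = 1 - r\<^sup>2" "0 < w" using p by (auto simp: r_def w_def)
  have "log_ratio \<theta> (proj0 \<theta>) (chol \<theta> (a, b)) =
      ln w + 0 * a + 0 * b + (- r\<^sup>2 / 2) * a\<^sup>2 + (- r * w) * (a * b) + ((1 - w\<^sup>2) / 2) * b\<^sup>2" for a b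
  proof -
    have "(fst \<theta> $ 2 + sd 2 \<theta> * corr \<theta> * a + sd 2 \<theta> * resid_sd \<theta> * b - fst \<theta> $ 2) / sd 2 \<theta> = r * a + w * b"
      using p by (simp add: r_def w_def add_divide_distrib)
    then have "log_ratio \<theta> (proj0 \<theta>) (chol \<theta> (a, b)) = (a\<^sup>2 + b\<^sup>2) / 2 - (a\<^sup>2 + (r * a + w * b)\<^sup>2) / 2 + ln w"
      unfolding log_ratio_chol[OF \<theta> \<theta>0] proj0_params using p by (simp add: w_def)
    then show ?thesis by (simp add: power2_eq_square field_simps)
  qed
  from gauss_law_quadratic(2)[OF \<theta> _ this]
  have "KL_info \<theta> (proj0 \<theta>) = - ln w"
    using integral_log_ratio[of \<theta> "proj0 \<theta>"] by (simp add: w)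
  also have "ln w = ln (1 - r\<^sup>2) / 2"
    using ln_realpow[of w 2] w by simp
  finally show ?thesis by (simp add: r_def)
qed

section \<open>Bahadur's bound for the p-value\<close>

lemma PiM_density:
  assumes I: "finite I" and N: "sigma_finite_measure N" and f [measurable]: "f \<in> borel_measurable N"
    and D: "sigma_finite_measure (density N f)"
  shows "PiM I (\<lambda>_. density N f) = density (PiM I (\<lambda>_. N)) (\<lambda>z. \<Prod>i\<in>I. f (z i))"
proof -
  interpret N: product_sigma_finite "\<lambda>_. N" by (simp add: product_sigma_finite_def N)
  interpret D: product_sigma_finite "\<lambda>_. density N f" by (simp add: product_sigma_finite_def D)
  have "density (PiM I (\<lambda>_. N)) (\<lambda>z. \<Prod>i\<in>I. f (z i)) = PiM I (\<lambda>_. density N f)"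
  proof (rule D.PiM_eqI[OF I])
    show "sets (density (PiM I (\<lambda>_. N)) (\<lambda>z. \<Prod>i\<in>I. f (z i))) = sets (PiM I (\<lambda>_. density N f))"
      by (simp cong: sets_PiM_cong)
    fix A assume "\<And>i. i \<in> I \<Longrightarrow> A i \<in> sets (density N f)"
    then have A [measurable]: "\<And>i. i \<in> I \<Longrightarrow> A i \<in> sets N" by simp
    have PA: "Pi\<^sub>E I A \<in> sets (PiM I (\<lambda>_. N))"
      using I A by (intro sets_PiM_I_finite) auto
    have "emeasure (density (PiM I (\<lambda>_. N)) (\<lambda>z. \<Prod>i\<in>I. f (z i))) (Pi\<^sub>E I A) =
        (\<integral>\<^sup>+ z. (\<Prod>i\<in>I. f (z i)) * indicator (Pi\<^sub>E I A) z \<partial>PiM I (\<lambda>_. N))"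
      by (intro emeasure_density PA) measurable
    also have "\<dots> = (\<integral>\<^sup>+ z. (\<Prod>i\<in>I. f (z i) * indicator (A i) (z i)) \<partial>PiM I (\<lambda>_. N))"
      using I by (intro nn_integral_cong) (auto simp: prod.distrib indicator_def PiE_iff space_PiM)
    also have "\<dots> = (\<Prod>i\<in>I. \<integral>\<^sup>+ x. f x * indicator (A i) x \<partial>N)"
      using A by (intro N.product_nn_integral_prod[OF I]) measurable
    also have "\<dots> = (\<Prod>i\<in>I. emeasure (density N f) (A i))"
      using A by (intro prod.cong) (auto simp: emeasure_density)
    finally show "emeasure (density (PiM I (\<lambda>_. N)) (\<lambda>z. \<Prod>i\<in>I. f (z i))) (Pi\<^sub>E I A) =
      (\<Prod>i\<in>I. emeasure (density N f) (A i))" .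
  qed
  then show ?thesis ..
qed

text \<open>Likelihood ratios require a finite number of observations: the infinite product laws of
  distinct parameters are mutually singular.\<close>

definition sample_law :: "nat \<Rightarrow> param \<Rightarrow> (nat \<Rightarrow> real^2) measure" where
  "sample_law n \<theta> = PiM {1..n} (\<lambda>_. gauss_law \<theta>)"

abbreviation sample_space :: "nat \<Rightarrow> (nat \<Rightarrow> real^2) measure" where
  "sample_space n \<equiv> PiM {1..n} (\<lambda>_. borel)"

lemma sets_gauss_law [measurable_cong, simp]: "sets (gauss_law \<theta>) = sets borel"
  by (simp add: gauss_law_def)

lemma sets_sample_law [measurable_cong, simp]: "sets (sample_law n \<theta>) = sets (sample_space n)"
  unfolding sample_law_def by (intro sets_PiM_cong) auto

lemma space_sample_law [simp]: "space (sample_law n \<theta>) = space (sample_space n)"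
  by (rule sets_eq_imp_space_eq) simp

lemma sample_law_change_of_measure:
  assumes \<theta>: "\<theta> \<in> Theta" and \<theta>0: "\<theta>0 \<in> Theta"
    and A: "A \<in> sets (sample_space n)" and c: "0 \<le> c"
    and le: "\<And>z. z \<in> A \<Longrightarrow> (\<Prod>i=1..n. gauss_density \<theta> (z i)) \<le> c * (\<Prod>i=1..n. gauss_density \<theta>0 (z i))"
  shows "emeasure (sample_law n \<theta>) A \<le> ennreal c * emeasure (sample_law n \<theta>0) A"
proof -
  let ?L = "PiM {1..n} (\<lambda>_. lborel :: (real^2) measure)"
  have sets: "sets ?L = sets (sample_space n)"
    by (intro sets_PiM_cong) auto
  have law: "sample_law n \<eta> = density ?L (\<lambda>z. \<Prod>i=1..n. ennreal (gauss_density \<eta> (z i)))" if "\<eta> \<in> Theta" for \<eta>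
    unfolding sample_law_def gauss_law_def
  proof (rule PiM_density)
    interpret prob_space "gauss_law \<eta>" by (rule prob_space_gauss_law[OF that])
    show "sigma_finite_measure (density lborel (\<lambda>x. ennreal (gauss_density \<eta> x)))"
      unfolding gauss_law_def[symmetric] by unfold_locales
    show "(\<lambda>x. ennreal (gauss_density \<eta> x)) \<in> borel_measurable lborel"
      using borel_measurable_gauss_density[OF that] by measurable
  qed (auto simp: sigma_finite_lborel)
  have meas [measurable]: "(\<lambda>z. \<Prod>i=1..n. ennreal (gauss_density \<eta> (z i))) \<in> borel_measurable ?L" if "\<eta> \<in> Theta" for \<eta>
  proof -
    note [measurable] = borel_measurable_gauss_density[OF that]
    show ?thesis by measurable
  qed
  have prod: "(\<Prod>i=1..n. ennreal (gauss_density \<eta> (z i))) = ennreal (\<Prod>i=1..n. gauss_density \<eta> (z i))" if "\<eta> \<in> Theta" for \<eta> z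
    using gauss_density_pos[OF that] by (intro prod_ennreal) (simp add: less_imp_le)
  have "emeasure (sample_law n \<theta>) A = (\<integral>\<^sup>+ z. (\<Prod>i=1..n. ennreal (gauss_density \<theta> (z i))) * indicator A z \<partial>?L)"
    unfolding law[OF \<theta>] using \<theta> A by (intro emeasure_density meas) (simp_all only: sets)
  also have "\<dots> \<le> (\<integral>\<^sup>+ z. ennreal c * ((\<Prod>i=1..n. ennreal (gauss_density \<theta>0 (z i))) * indicator A z) \<partial>?L)"
  proof (intro nn_integral_mono)
    fix z
    show "(\<Prod>i=1..n. ennreal (gauss_density \<theta> (z i))) * indicator A z \<le>
        ennreal c * ((\<Prod>i=1..n. ennreal (gauss_density \<theta>0 (z i))) * indicator A z)"
      unfolding prod[OF \<theta>] prod[OF \<theta>0] using le[of z] c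
      by (cases "z \<in> A") (auto simp: ennreal_mult'[symmetric] intro!: ennreal_leI)
  qed
  also have "\<dots> = ennreal c * (\<integral>\<^sup>+ z. (\<Prod>i=1..n. ennreal (gauss_density \<theta>0 (z i))) * indicator A z \<partial>?L)"
    using \<theta>0 A
    by (intro nn_integral_cmult borel_measurable_times_ennreal meas borel_measurable_indicator) (simp_all only: sets)
  also have "(\<integral>\<^sup>+ z. (\<Prod>i=1..n. ennreal (gauss_density \<theta>0 (z i))) * indicator A z \<partial>?L) = emeasure (sample_law n \<theta>0) A"
    unfolding law[OF \<theta>0] using \<theta>0 A by (intro emeasure_density[symmetric] meas) (simp_all only: sets)
  finally show ?thesis .
qed

text \<open>The event is \<open>T \<in> U\<close> for an up-set \<open>U\<close>, a countable increasing union of closed half-lines.\<close>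

lemma emeasure_p_value_le:
  fixes T :: "'a \<Rightarrow> real" and g :: "real \<Rightarrow> real"
  assumes T [measurable]: "T \<in> borel_measurable Q" and g: "antimono g"
    and tail: "\<And>t. emeasure Q {x \<in> space Q. t \<le> T x} \<le> ennreal (g t)"
  shows "emeasure Q {x \<in> space Q. g (T x) \<le> u} \<le> ennreal u"
proof -
  define U where "U = {t. g t \<le> u}"
  have up: "t' \<in> U" if "t \<in> U" "t \<le> t'" for t t'
    using that antimonoD[OF g, of t t'] by (auto simp: U_def)
  have bound: "emeasure Q {x \<in> space Q. t \<le> T x} \<le> ennreal u" if "t \<in> U" for t
    by (rule order_trans[OF tail ennreal_leI]) (use that in \<open>simp add: U_def\<close>)
  have ev: "{x \<in> space Q. g (T x) \<le> u} = {x \<in> space Q. T x \<in> U}"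
    by (auto simp: U_def)
  consider "U = {}" | m where "m \<in> U" "\<And>t. t \<in> U \<Longrightarrow> m \<le> t" | "U \<noteq> {}" "\<And>t. t \<in> U \<Longrightarrow> \<exists>t'\<in>U. t' < t"
  proof (cases "\<exists>m\<in>U. \<forall>t\<in>U. m \<le> t")
    case False
    then have "\<exists>t'\<in>U. t' < t" if "t \<in> U" for t
      using that by (auto simp: not_le)
    then show ?thesis using that(1,3) by blast
  qed (use that(2) in blast)
  then show ?thesis
  proof cases
    case 1
    then show ?thesis unfolding ev by simp
  next
    case (2 m)
    then have "{x \<in> space Q. T x \<in> U} = {x \<in> space Q. m \<le> T x}"
      using up[OF 2(1)] 2(2) by blast
    then show ?thesis unfolding ev using bound[OF 2(1)] by simp
  next
    case 3
    define R where "R = U \<inter> \<rat>"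
    have below: "\<exists>q\<in>R. q \<le> t" if "t \<in> U" for t
    proof -
      obtain t' where "t' \<in> U" "t' < t" using 3(2)[OF \<open>t \<in> U\<close>] by auto
      moreover obtain q where "q \<in> \<rat>" "t' < q" "q < t" using Rats_dense_in_real[OF \<open>t' < t\<close>] by auto
      ultimately show ?thesis using up[of t' q] by (auto simp: R_def intro!: bexI[of _ q])
    qed
    have R: "countable R" "R \<noteq> {}"
      using below 3(1) by (auto simp: R_def countable_rat)
    \<comment> \<open>Running minima of an enumeration decrease, so the half-lines above them
      increase and continuity from below applies.\<close>
    define q where "q k = Min (from_nat_into R ` {..k})" for k
    have qU: "q k \<in> U" for k
    proof -
      have "q k \<in> from_nat_into R ` {..k}" unfolding q_def by (intro Min_in) auto
      then show ?thesis using from_nat_into[OF R(2)] by (auto simp: R_def)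
    qed
    have "{x \<in> space Q. T x \<in> U} = (\<Union>k. {x \<in> space Q. q k \<le> T x})"
    proof safe
      fix x assume "x \<in> space Q" "T x \<in> U"
      then obtain r where "r \<in> R" "r \<le> T x" using below by blast
      then obtain k where "r = from_nat_into R k"
        using from_nat_into_surj[OF R(1)] by metis
      then have "q k \<le> r" by (auto simp: q_def)
      then show "x \<in> (\<Union>k. {x \<in> space Q. q k \<le> T x})"
        using \<open>r \<le> T x\<close> \<open>x \<in> space Q\<close> by (auto intro!: exI[of _ k])
    qed (use qU up in blast)
    moreover have "incseq (\<lambda>k. {x \<in> space Q. q k \<le> T x})"
    proof (intro incseq_SucI subsetI)
      fix k x assume "x \<in> {x \<in> space Q. q k \<le> T x}"
      moreover have "q (Suc k) \<le> q k" unfolding q_def by (intro Min_antimono) auto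
      ultimately show "x \<in> {x \<in> space Q. q (Suc k) \<le> T x}" by auto
    qed
    moreover have "range (\<lambda>k. {x \<in> space Q. q k \<le> T x}) \<subseteq> sets Q"
      by auto
    ultimately have "emeasure Q {x \<in> space Q. T x \<in> U} = (SUP k. emeasure Q {x \<in> space Q. q k \<le> T x})"
      using SUP_emeasure_incseq[of "\<lambda>k. {x \<in> space Q. q k \<le> T x}" Q] by auto
    also have "\<dots> \<le> ennreal u" by (intro SUP_least bound qU)
    finally show ?thesis unfolding ev .
  qed
qed

text \<open>Common setting for the two-sided and the signed statistic. \<open>S_restrict\<close>
  expresses dependence on the first n observations and carries tails from the infinite product to
  \<open>sample_law\<close>.\<close>

locale sample_statistic =
  fixes S :: "nat \<Rightarrow> (nat \<Rightarrow> real^2) \<Rightarrow> real"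
  assumes measurable_S [measurable]: "S n \<in> borel_measurable (sample_space n)"
    and S_restrict: "S n (restrict z {1..n}) = S n z"
begin

lemma iid_law_tail:
  assumes \<theta>: "\<theta> \<in> Theta"
  shows "emeasure (iid_law \<theta>) {z \<in> space (iid_law \<theta>). t \<le> S n z} =
      emeasure (sample_law n \<theta>) {z \<in> space (sample_law n \<theta>). t \<le> S n z}"
proof -
  interpret G: prob_space "gauss_law \<theta>" by (rule prob_space_gauss_law[OF \<theta>])
  interpret P: product_prob_space "\<lambda>_. gauss_law \<theta>" "{1..} :: nat set" ..
  have "sample_law n \<theta> = distr (iid_law \<theta>) (sample_law n \<theta>) (\<lambda>z. restrict z {1..n})"
    unfolding sample_law_def iid_law_def by (subst P.distr_PiM_restrict_finite) auto
  then have "emeasure (sample_law n \<theta>) {z \<in> space (sample_law n \<theta>). t \<le> S n z} =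
      emeasure (distr (iid_law \<theta>) (sample_law n \<theta>) (\<lambda>z. restrict z {1..n})) {z \<in> space (sample_law n \<theta>). t \<le> S n z}"
    by simp
  also have "\<dots> = emeasure (iid_law \<theta>) ((\<lambda>z. restrict z {1..n}) -` {z \<in> space (sample_law n \<theta>). t \<le> S n z} \<inter> space (iid_law \<theta>))"
  proof (rule emeasure_distr)
    show "(\<lambda>z. restrict z {1..n}) \<in> measurable (iid_law \<theta>) (sample_law n \<theta>)"
      unfolding iid_law_def sample_law_def by (intro measurable_restrict_subset) auto
    show "{z \<in> space (sample_law n \<theta>). t \<le> S n z} \<in> sets (sample_law n \<theta>)"
      by measurable
  qed
  also have "(\<lambda>z. restrict z {1..n}) -` {z \<in> space (sample_law n \<theta>). t \<le> S n z} \<inter> space (iid_law \<theta>) =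
      {z \<in> space (iid_law \<theta>). t \<le> S n z}"
    by (auto simp: S_restrict simp del: One_nat_def) (auto simp: space_PiM)
  finally show ?thesis ..
qed

lemma prob_space_iid_law: "\<theta> \<in> Theta \<Longrightarrow> prob_space (iid_law \<theta>)"
  unfolding iid_law_def by (intro prob_space_PiM prob_space_gauss_law)

text \<open>The supremum in \<open>null_tail\<close> is taken in the reals, where it dominates its
  members only for a set bounded above.\<close>

lemma bdd_above_tails: "bdd_above ((\<lambda>\<theta>. measure (iid_law \<theta>) {z \<in> space (iid_law \<theta>). t \<le> S n z}) ` Theta0)"
  by (intro bdd_aboveI[of _ 1]) (auto simp: Theta0_def intro!: prob_space.prob_le_1 prob_space_iid_law)

lemma tail_le_null_tail:
  assumes "\<theta>0 \<in> Theta0"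
  shows "emeasure (sample_law n \<theta>0) {z \<in> space (sample_law n \<theta>0). t \<le> S n z} \<le> ennreal (null_tail S n t)"
proof -
  have \<theta>0: "\<theta>0 \<in> Theta" using assms by (simp add: Theta0_def)
  interpret prob_space "iid_law \<theta>0" by (rule prob_space_iid_law[OF \<theta>0])
  show ?thesis
    unfolding iid_law_tail[OF \<theta>0, symmetric] emeasure_eq_measure null_tail_def
    by (intro ennreal_leI cSUP_upper assms bdd_above_tails)
qed

lemma Theta0_nonempty: "Theta0 \<noteq> {}"
proof -
  have "0 < v \<bullet> (mat 1 *v v)" if "v \<noteq> 0" for v :: "real^2"
    using that by (simp add: matrix_vector_mul_lid)
  then have "(0, mat 1) \<in> Theta0"
    by (auto simp: Theta0_def Theta_def corr_def mat_def transpose_mat[unfolded mat_def])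
  then show ?thesis by auto
qed

lemma antimono_null_tail: "antimono (null_tail S n)"
proof (rule antimonoI)
  fix t t' :: real assume le: "t \<le> t'"
  have "measure (iid_law \<eta>) {z \<in> space (iid_law \<eta>). t' \<le> S n z} \<le>
      measure (iid_law \<eta>) {z \<in> space (iid_law \<eta>). t \<le> S n z}" if \<eta>: "\<eta> \<in> Theta0" for \<eta>
  proof -
    have \<eta>': "\<eta> \<in> Theta" using \<eta> by (simp add: Theta0_def)
    interpret I: prob_space "iid_law \<eta>" by (rule prob_space_iid_law[OF \<eta>'])
    have "{z \<in> space (sample_law n \<eta>). t' \<le> S n z} \<subseteq> {z \<in> space (sample_law n \<eta>). t \<le> S n z}"
      using le by force
    moreover have "{z \<in> space (sample_law n \<eta>). t \<le> S n z} \<in> sets (sample_law n \<eta>)"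
      by measurable
    ultimately have "emeasure (sample_law n \<eta>) {z \<in> space (sample_law n \<eta>). t' \<le> S n z} \<le>
        emeasure (sample_law n \<eta>) {z \<in> space (sample_law n \<eta>). t \<le> S n z}"
      by (rule emeasure_mono)
    then show ?thesis
      unfolding iid_law_tail[OF \<eta>', symmetric] I.emeasure_eq_measure by simp
  qed
  then show "null_tail S n t' \<le> null_tail S n t"
    unfolding null_tail_def by (intro cSUP_mono[OF Theta0_nonempty bdd_above_tails]) blast
qed

lemma null_tail_le:
  assumes "\<And>\<theta>0. \<theta>0 \<in> Theta0 \<Longrightarrow>
    emeasure (sample_law n \<theta>0) {z \<in> space (sample_law n \<theta>0). t \<le> S n z} \<le> ennreal B" and "0 \<le> B"
  shows "null_tail S n t \<le> B"
  unfolding null_tail_def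
proof (rule cSUP_least[OF Theta0_nonempty])
  fix \<eta> assume \<eta>: "\<eta> \<in> Theta0"
  then have \<eta>': "\<eta> \<in> Theta" by (simp add: Theta0_def)
  interpret I: prob_space "iid_law \<eta>" by (rule prob_space_iid_law[OF \<eta>'])
  show "measure (iid_law \<eta>) {z \<in> space (iid_law \<eta>). t \<le> S n z} \<le> B"
    using assms(1)[OF \<eta>] assms(2) unfolding iid_law_tail[OF \<eta>', symmetric] I.emeasure_eq_measure
    by (simp add: ennreal_le_iff)
qed

text \<open>Bahadur's lower bound for the \<open>p\<close>-value: on the event that the likelihood ratio against
  \<open>\<theta>0\<close> is at most \<open>exp (n (K + \<delta>))\<close>, the change of measure gives
  \<open>P\<^sub>\<theta> (p-value \<le> exp (- n (K + 2\<delta>))) \<le> exp (- n \<delta>)\<close>, which is summable.\<close>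

lemma null_tail_lower_bound:
  fixes M :: "'a measure" and Z :: "nat \<Rightarrow> 'a \<Rightarrow> real^2"
  assumes M: "prob_space M" and \<theta>: "\<theta> \<in> Theta" and \<theta>0: "\<theta>0 \<in> Theta0" and \<delta>: "0 < \<delta>"
    and indep: "prob_space.indep_vars M (\<lambda>_. borel) Z {1..}"
    and distr: "\<And>i. 1 \<le> i \<Longrightarrow> distr M borel (Z i) = gauss_law \<theta>"
  shows "AE \<omega> in M. \<forall>\<^sub>F n in sequentially.
    exp (- real n * (KL_info \<theta> \<theta>0 + 2 * \<delta>)) < null_tail S n (S n (\<lambda>i. Z i \<omega>))"
proof -
  interpret prob_space M by fact
  have \<theta>0': "\<theta>0 \<in> Theta" using \<theta>0 by (simp add: Theta0_def)
  define K where "K = KL_info \<theta> \<theta>0"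
  note [measurable] = borel_measurable_gauss_density[OF \<theta>] borel_measurable_gauss_density[OF \<theta>0']
  have Z [measurable]: "Z i \<in> borel_measurable M" if "1 \<le> i" for i
    using indep that by (auto simp: indep_vars_def)
  \<comment> \<open>\<open>u n\<close> is the threshold for the p-value and \<open>c n\<close> the
    allowed likelihood ratio; their product is exp (- n \<delta>).\<close>
  define u c where "u n = exp (- real n * (K + 2 * \<delta>))" and "c n = exp (real n * (K + \<delta>))" for n
  \<comment> \<open>The bad event: a too small p-value although the likelihood ratio is within its
    allowed size.\<close>
  define A where "A n = {z \<in> space (sample_space n). null_tail S n (S n z) \<le> u n \<and>
    (\<Prod>i=1..n. gauss_density \<theta> (z i)) \<le> c n * (\<Prod>i=1..n. gauss_density \<theta>0 (z i))}" for n
  define ZZ where "ZZ n \<omega> = (\<lambda>i\<in>{1..n}. Z i \<omega>)" for n \<omega>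
  have "null_tail S n \<in> borel_measurable borel" for n
  proof -
    have "mono (\<lambda>t. - null_tail S n t)"
      using antimono_null_tail[of n] by (auto simp: mono_def antimono_def)
    then have "(\<lambda>t. - null_tail S n t) \<in> borel_measurable borel"
      by (rule borel_measurable_mono)
    from borel_measurable_uminus[OF this] show ?thesis by simp
  qed
  note [measurable] = this
  have A [measurable]: "A n \<in> sets (sample_space n)" for n
  proof -
    have "(\<lambda>z. \<Prod>i=1..n. gauss_density \<eta> (z i)) \<in> borel_measurable (sample_space n)"
      if "gauss_density \<eta> \<in> borel_measurable borel" for \<eta>
    proof (rule borel_measurable_prod)
      fix i assume i: "i \<in> {1..n}"
      show "(\<lambda>z. gauss_density \<eta> (z i)) \<in> borel_measurable (sample_space n)"
        by (rule measurable_compose[OF measurable_component_singleton[OF i, of "\<lambda>_. borel"] that])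
    qed
    note pm = this[OF borel_measurable_gauss_density[OF \<theta>]] this[OF borel_measurable_gauss_density[OF \<theta>0']]
    have "A n = {z \<in> space (sample_space n). null_tail S n (S n z) \<le> u n} \<inter>
        {z \<in> space (sample_space n). (\<Prod>i=1..n. gauss_density \<theta> (z i)) \<le> c n * (\<Prod>i=1..n. gauss_density \<theta>0 (z i))}"
      by (auto simp: A_def)
    then show ?thesis
      by (simp only:) (intro sets.Int borel_measurable_le borel_measurable_times borel_measurable_const pm, measurable)
  qed
  have ZZ [measurable]: "ZZ n \<in> measurable M (sample_space n)" for n
    unfolding ZZ_def by (intro measurable_restrict) auto
  have law: "distr M (sample_space n) (ZZ n) = sample_law n \<theta>" if "n > 0" for n
  proof -
    have "indep_vars (\<lambda>_. borel) Z {1..n}"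
      by (rule indep_vars_subset[OF indep]) auto
    then have "distr M (sample_space n) (ZZ n) = PiM {1..n} (\<lambda>i. distr M borel (Z i))"
      using that unfolding ZZ_def by (subst (asm) indep_vars_iff_distr_eq_PiM') auto
    also have "\<dots> = sample_law n \<theta>"
      unfolding sample_law_def by (intro PiM_cong) (auto simp: distr)
    finally show ?thesis .
  qed
  \<comment> \<open>Indexed by \<open>Suc n\<close> because \<open>law\<close> identifies the joint
    law only for a nonempty set of indices.\<close>
  have probA: "prob (ZZ (Suc n) -` A (Suc n) \<inter> space M) \<le> exp (- \<delta>) ^ Suc n" for n
  proof -
    let ?n = "Suc n"
    have "emeasure M (ZZ ?n -` A ?n \<inter> space M) = emeasure (sample_law ?n \<theta>) (A ?n)"
      unfolding law[OF zero_less_Suc, symmetric] by (rule emeasure_distr[symmetric, OF ZZ A])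
    also have "\<dots> \<le> ennreal (c ?n) * emeasure (sample_law ?n \<theta>0) (A ?n)"
      by (intro sample_law_change_of_measure \<theta> \<theta>0' A) (auto simp: c_def A_def)
    also have "emeasure (sample_law ?n \<theta>0) (A ?n) \<le>
        emeasure (sample_law ?n \<theta>0) {z \<in> space (sample_law ?n \<theta>0). null_tail S ?n (S ?n z) \<le> u ?n}"
    proof (rule emeasure_mono)
      show "{z \<in> space (sample_law ?n \<theta>0). null_tail S ?n (S ?n z) \<le> u ?n} \<in> sets (sample_law ?n \<theta>0)"
        by measurable
    qed (auto simp: A_def)
    also have "\<dots> \<le> ennreal (u ?n)"
      by (intro emeasure_p_value_le antimono_null_tail tail_le_null_tail \<theta>0) measurable
    finally have "emeasure M (ZZ ?n -` A ?n \<inter> space M) \<le> ennreal (c ?n) * ennreal (u ?n)"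
      by (simp add: mult_left_mono)
    also have "\<dots> = ennreal (c ?n * u ?n)"
      by (simp add: ennreal_mult'[symmetric] c_def)
    also have "c ?n * u ?n = exp (- \<delta>) ^ ?n"
      unfolding c_def u_def exp_add[symmetric] exp_of_nat_mult[symmetric] by (simp add: algebra_simps)
    finally show ?thesis
      by (simp add: emeasure_eq_measure ennreal_le_iff)
  qed
  have "summable (\<lambda>n. exp (- \<delta>) ^ Suc n)"
    using \<delta> by (subst summable_Suc_iff) (auto intro!: summable_geometric)
  then have "summable (\<lambda>n. prob (ZZ (Suc n) -` A (Suc n) \<inter> space M))"
    by (rule summable_comparison_test'[where N = 0]) (use probA in auto)
  then have "AE \<omega> in M. \<forall>\<^sub>F n in sequentially. \<omega> \<in> space M - (ZZ (Suc n) -` A (Suc n) \<inter> space M)"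
    by (intro borel_cantelli_AE1) (auto simp: emeasure_eq_measure intro!: measurable_sets[OF ZZ])
  moreover have "AE \<omega> in M. (\<lambda>n. (\<Sum>i=1..n. log_ratio \<theta> \<theta>0 (Z i \<omega>)) / real n) \<longlonglongrightarrow> (\<integral>x. log_ratio \<theta> \<theta>0 x \<partial>gauss_law \<theta>)"
    by (intro strong_law[OF indep distr] borel_measurable_log_ratio integrable_log_ratio_square \<theta> \<theta>0 \<theta>0')
  ultimately show ?thesis
  proof eventually_elim
    case (elim \<omega>)
    have "\<forall>\<^sub>F n in sequentially. \<omega> \<in> space M - (ZZ n -` A n \<inter> space M)"
      using elim(1) by (subst (asm) eventually_sequentially_Suc[of "\<lambda>n. \<omega> \<in> space M - (ZZ n -` A n \<inter> space M)"])
    \<comment> \<open>The average log ratio tends to -K, so the likelihood condition in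
      \<open>A n\<close> holds eventually; staying outside \<open>A n\<close> then forces the
      p-value above \<open>u n\<close>.\<close>
    moreover have "\<forall>\<^sub>F n in sequentially. - K - \<delta> < (\<Sum>i=1..n. log_ratio \<theta> \<theta>0 (Z i \<omega>)) / real n"
      using elim(2) \<delta> unfolding integral_log_ratio by (intro order_tendstoD(1)) (auto simp: K_def)
    ultimately show ?case
      using eventually_gt_at_top[of 0]
    proof eventually_elim
      case (elim n)
      have \<omega>: "\<omega> \<in> space M" "ZZ n \<omega> \<notin> A n" using elim(1) by auto
      define f g where "f = (\<Prod>i=1..n. gauss_density \<theta> (Z i \<omega>))" and "g = (\<Prod>i=1..n. gauss_density \<theta>0 (Z i \<omega>))"
      have pos: "0 < f" "0 < g"
        using gauss_density_pos[OF \<theta>] gauss_density_pos[OF \<theta>0'] by (auto simp: f_def g_def intro!: prod_pos)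
      have "(\<Sum>i=1..n. log_ratio \<theta> \<theta>0 (Z i \<omega>)) = (\<Sum>i=1..n. ln (gauss_density \<theta>0 (Z i \<omega>)) - ln (gauss_density \<theta> (Z i \<omega>)))"
        unfolding log_ratio_def using gauss_density_pos[OF \<theta>] gauss_density_pos[OF \<theta>0']
        by (intro sum.cong) (auto simp: ln_divide_pos)
      also have "\<dots> = ln g - ln f"
        unfolding f_def g_def sum_subtractf using gauss_density_pos[OF \<theta>] gauss_density_pos[OF \<theta>0']
        by (subst (1 2) ln_prod) (auto simp: less_imp_neq[symmetric])
      finally have "ln f < real n * (K + \<delta>) + ln g"
        using elim(2,3) by (simp add: field_simps)
      then have "exp (ln f) < exp (real n * (K + \<delta>) + ln g)" by simp
      then have "f < c n * g" using pos by (simp add: exp_add c_def)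
      moreover have "(\<Prod>i=1..n. gauss_density \<theta> (ZZ n \<omega> i)) = f" "(\<Prod>i=1..n. gauss_density \<theta>0 (ZZ n \<omega> i)) = g"
        unfolding f_def g_def ZZ_def by (auto intro!: prod.cong)
      moreover have "S n (ZZ n \<omega>) = S n (\<lambda>i. Z i \<omega>)"
        unfolding ZZ_def by (rule S_restrict)
      ultimately show ?case
        using \<omega> measurable_space[OF ZZ \<omega>(1)] by (auto simp: A_def u_def K_def)
    qed
  qed
qed

end

section \<open>The exact slope\<close>

lemma measurable_pearson [measurable]: "pearson n \<in> borel_measurable (sample_space n)"
  unfolding pearson_eq_corr_coeff by (intro measurable_corr_coeff) measurable

lemma pearson_restrict: "pearson n (restrict z {1..n}) = pearson n z"
  by (rule pearson_cong) auto

text \<open>At zero correlation \<open>resid_sd\<close> is 1 and \<open>chol\<close> acts on each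
  coordinate separately, which is the situation of \<open>emeasure_pearson_std\<close>.\<close>

lemma emeasure_pearson_null:
  assumes \<theta>0: "\<theta>0 \<in> Theta0" and s: "0 < s" and \<kappa>: "0 \<le> \<kappa>" "\<kappa> / s\<^sup>2 < 1 + \<kappa>"
  shows "emeasure (sample_law n \<theta>0) {z \<in> space (sample_law n \<theta>0). s \<le> \<bar>pearson n z\<bar>} \<le>
    ennreal (tail_const s \<kappa> / sqrt (1 + \<kappa>) ^ n)"
proof -
  have \<theta>0': "\<theta>0 \<in> Theta" "corr \<theta>0 = 0" using \<theta>0 by (auto simp: Theta0_def)
  have "chol \<theta>0 = (\<lambda>(x, y). vector [fst \<theta>0 $ 1 + sd 1 \<theta>0 * x, fst \<theta>0 $ 2 + sd 2 \<theta>0 * y])"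
    by (auto simp: chol_def \<theta>0' resid_sd_def)
  then show ?thesis
    unfolding sample_law_def gauss_law_eq_distr[OF \<theta>0'(1)]
    using emeasure_pearson_std[OF s \<kappa> Theta_params(1)[OF \<theta>0'(1)] Theta_params(2)[OF \<theta>0'(1)]] by simp
qed

lemma strong_law_quadratic:
  fixes M :: "'a measure" and Z :: "nat \<Rightarrow> 'a \<Rightarrow> real^2"
  assumes M: "prob_space M" and \<theta>: "\<theta> \<in> Theta"
    and indep: "prob_space.indep_vars M (\<lambda>_. borel) Z {1..}"
    and distr: "\<And>i. 1 \<le> i \<Longrightarrow> distr M borel (Z i) = gauss_law \<theta>"
    and h: "h \<in> borel_measurable borel"
    and quad: "\<And>a b. h (chol \<theta> (a, b)) = ka + kb * a + kc * b + kd * a\<^sup>2 + ke * (a * b) + kf * b\<^sup>2"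
  shows "AE \<omega> in M. (\<lambda>n. (\<Sum>i=1..n. h (Z i \<omega>)) / real n) \<longlonglongrightarrow> ka + kd + kf"
  using prob_space.strong_law[OF M indep distr h gauss_law_quadratic(1)[OF \<theta> h quad]]
  unfolding gauss_law_quadratic(2)[OF \<theta> h quad] by simp

text \<open>The coefficient is a continuous function of five empirical moments, each an average of a
  quadratic polynomial in the underlying normals.\<close>

lemma pearson_tendsto_corr:
  fixes M :: "'a measure" and Z :: "nat \<Rightarrow> 'a \<Rightarrow> real^2"
  assumes M: "prob_space M" and \<theta>: "\<theta> \<in> Theta"
    and indep: "prob_space.indep_vars M (\<lambda>_. borel) Z {1..}"
    and distr: "\<And>i. 1 \<le> i \<Longrightarrow> distr M borel (Z i) = gauss_law \<theta>"
  shows "AE \<omega> in M. (\<lambda>n. pearson n (\<lambda>i. Z i \<omega>)) \<longlonglongrightarrow> corr \<theta>"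
proof -
  interpret prob_space M by fact
  note p = Theta_params[OF \<theta>]
  define a1 b1 where "a1 = fst \<theta> $ 1" and "b1 = sd 1 \<theta>"
  define a2 b2 c2 where "a2 = fst \<theta> $ 2" and "b2 = sd 2 \<theta> * corr \<theta>" and "c2 = sd 2 \<theta> * resid_sd \<theta>"
  \<comment> \<open>The instantiated coefficients of a, b and ab do not appear in the conclusion, so
    unification cannot find them; the limit is the constant term plus the two pure square
    coefficients.\<close>
  have "AE \<omega> in M. (\<lambda>n. (\<Sum>i=1..n. Z i \<omega> $ 1) / real n) \<longlonglongrightarrow> a1 + 0 + 0"
    by (rule strong_law_quadratic[OF M \<theta> indep distr, where kb = b1 and kc = 0 and ke = 0]) (auto simp: a1_def b1_def)
  moreover have "AE \<omega> in M. (\<lambda>n. (\<Sum>i=1..n. Z i \<omega> $ 2) / real n) \<longlonglongrightarrow> a2 + 0 + 0"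
    by (rule strong_law_quadratic[OF M \<theta> indep distr, where kb = b2 and kc = c2 and ke = 0]) (auto simp: a2_def b2_def c2_def)
  moreover have "AE \<omega> in M. (\<lambda>n. (\<Sum>i=1..n. Z i \<omega> $ 1 * Z i \<omega> $ 1) / real n) \<longlonglongrightarrow> a1\<^sup>2 + b1\<^sup>2 + 0"
    by (rule strong_law_quadratic[OF M \<theta> indep distr, where kb = "2 * a1 * b1" and kc = 0 and ke = 0])
      (auto simp: a1_def b1_def power2_eq_square algebra_simps)
  moreover have "AE \<omega> in M. (\<lambda>n. (\<Sum>i=1..n. Z i \<omega> $ 2 * Z i \<omega> $ 2) / real n) \<longlonglongrightarrow> a2\<^sup>2 + b2\<^sup>2 + c2\<^sup>2"
    by (rule strong_law_quadratic[OF M \<theta> indep distr, where kb = "2 * a2 * b2" and kc = "2 * a2 * c2" and ke = "2 * b2 * c2"])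
      (auto simp: a2_def b2_def c2_def power2_eq_square algebra_simps)
  moreover have "AE \<omega> in M. (\<lambda>n. (\<Sum>i=1..n. Z i \<omega> $ 1 * Z i \<omega> $ 2) / real n) \<longlonglongrightarrow> a1 * a2 + b1 * b2 + 0"
    by (rule strong_law_quadratic[OF M \<theta> indep distr, where kb = "a1 * b2 + a2 * b1" and kc = "a1 * c2" and ke = "b1 * c2"])
      (auto simp: a1_def b1_def a2_def b2_def c2_def power2_eq_square algebra_simps)
  ultimately show ?thesis
  proof eventually_elim
    case (elim \<omega>)
    have "a2\<^sup>2 + b2\<^sup>2 + c2\<^sup>2 - a2 * a2 = (sd 2 \<theta>)\<^sup>2 * ((corr \<theta>)\<^sup>2 + (resid_sd \<theta>)\<^sup>2)"
      by (simp add: b2_def c2_def power2_eq_square algebra_simps)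
    then have v2: "a2\<^sup>2 + b2\<^sup>2 + c2\<^sup>2 - a2 * a2 = (sd 2 \<theta>)\<^sup>2"
      using p(5) by simp
    have v1: "a1\<^sup>2 + b1\<^sup>2 - a1 * a1 = (sd 1 \<theta>)\<^sup>2"
      by (simp add: b1_def power2_eq_square)
    have cov: "a1 * a2 + b1 * b2 - a1 * a2 = sd 1 \<theta> * sd 2 \<theta> * corr \<theta>"
      by (simp add: b1_def b2_def)
    have "(\<lambda>n. pearson n (\<lambda>i. Z i \<omega>)) \<longlonglongrightarrow>
        (sd 1 \<theta> * sd 2 \<theta> * corr \<theta>) / sqrt ((sd 1 \<theta>)\<^sup>2 * (sd 2 \<theta>)\<^sup>2)"
      unfolding pearson_eq_corr_coeff using p(1,2) elim
      by (subst v1[symmetric], subst v2[symmetric], subst cov[symmetric], intro corr_coeff_tendsto)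
        (simp_all add: v1[simplified] v2[simplified])
    then show ?case
      using p(1,2) by (simp add: real_sqrt_mult)
  qed
qed

section \<open>Exponential rate of the p-value\<close>

context sample_statistic
begin

text \<open>The one-sided inequality \<open>le\<close> reduces any admissible statistic to the
  two-sided coefficient; the resulting bound is uniform over the null parameters and so passes to
  the supremum.\<close>

lemma null_tail_upper_bound:
  assumes le: "\<And>n z. S n z \<le> sqrt (real n) * \<bar>pearson n z\<bar>"
    and s: "0 < s" and \<kappa>: "0 \<le> \<kappa>" "\<kappa> / s\<^sup>2 < 1 + \<kappa>" and n: "0 < n" and t: "sqrt (real n) * s \<le> t"
  shows "null_tail S n t \<le> tail_const s \<kappa> / sqrt (1 + \<kappa>) ^ n"
proof (rule null_tail_le)
  show "0 \<le> tail_const s \<kappa> / sqrt (1 + \<kappa>) ^ n"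
    using \<kappa> by (auto simp: tail_const_def)
  fix \<theta>0 assume \<theta>0: "\<theta>0 \<in> Theta0"
  have "emeasure (sample_law n \<theta>0) {z \<in> space (sample_law n \<theta>0). t \<le> S n z} \<le>
      emeasure (sample_law n \<theta>0) {z \<in> space (sample_law n \<theta>0). s \<le> \<bar>pearson n z\<bar>}"
  proof (rule emeasure_mono)
    show "{z \<in> space (sample_law n \<theta>0). s \<le> \<bar>pearson n z\<bar>} \<in> sets (sample_law n \<theta>0)"
      by measurable
    have "s \<le> \<bar>pearson n z\<bar>" if "t \<le> S n z" for z
    proof -
      have "sqrt (real n) * s \<le> sqrt (real n) * \<bar>pearson n z\<bar>"
        using t that le[of n z] by linarith
      then show ?thesis using n by simp
    qed
    then show "{z \<in> space (sample_law n \<theta>0). t \<le> S n z} \<subseteq> {z \<in> space (sample_law n \<theta>0). s \<le> \<bar>pearson n z\<bar>}"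
      by auto
  qed
  also have "\<dots> \<le> ennreal (tail_const s \<kappa> / sqrt (1 + \<kappa>) ^ n)"
    by (rule emeasure_pearson_null[OF \<theta>0 s \<kappa>])
  finally show "emeasure (sample_law n \<theta>0) {z \<in> space (sample_law n \<theta>0). t \<le> S n z} \<le>
    ennreal (tail_const s \<kappa> / sqrt (1 + \<kappa>) ^ n)" .
qed

text \<open>The tail bound is used with \<open>s\<close> just below |r| and \<kappa> just below its
  boundary value. Half of \<open>e\<close> pays for this loss in the rate, the other half for ln
  (tail_const) / n.\<close>

lemma eventually_log_null_tail_less:
  assumes le: "\<And>n z. S n z \<le> sqrt (real n) * \<bar>pearson n z\<bar>"
    and r: "0 < \<bar>r\<bar>" "\<bar>r\<bar> < 1" and lim: "(\<lambda>n. S n z / sqrt (real n)) \<longlonglongrightarrow> \<bar>r\<bar>"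
    and pos: "\<forall>\<^sub>F n in sequentially. 0 < null_tail S n (S n z)" and e: "0 < e"
  shows "\<forall>\<^sub>F n in sequentially. 1 / real n * ln (null_tail S n (S n z)) < ln (1 - r\<^sup>2) / 2 + e"
proof -
  have r2: "0 < r\<^sup>2" "r\<^sup>2 < 1" using r by (auto simp: abs_square_less_1)
  \<comment> \<open>With y = 1 + \<kappa> the condition \<kappa> / s^2 < 1 + \<kappa> reads 1 - 1 /
    y < s^2, so \<open>Y\<close> is the boundary value of \<open>y\<close> at s = |r|.\<close>
  define Y where "Y = 1 / (1 - r\<^sup>2)"
  have Y: "1 < Y" "ln Y = - ln (1 - r\<^sup>2)" using r2 by (auto simp: Y_def ln_div)
  have "max 1 (Y * exp (- e)) < Y" using Y(1) e by auto
  \<comment> \<open>The lower bound Y exp (-e) costs at most e / 2 in the rate, y > 1 gives a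
    positive \<kappa>, and y < Y leaves room for some s < |r|.\<close>
  then obtain y where y: "max 1 (Y * exp (- e)) < y" "y < Y" using dense by blast
  define \<kappa> where "\<kappa> = y - 1"
  have y1: "1 < y" "Y * exp (- e) < y" using y by auto
  have "ln (Y * exp (- e)) < ln y" using y1 Y by (subst ln_less_cancel_iff) auto
  then have lny: "- ln y / 2 < ln (1 - r\<^sup>2) / 2 + e / 2"
    using Y by (simp add: ln_mult_pos)
  have "1 / Y < 1 / y" using y1 y(2) by (intro divide_strict_left_mono) auto
  then have "1 - 1 / y < r\<^sup>2" using r2 by (simp add: Y_def)
  then have "sqrt (1 - 1 / y) < \<bar>r\<bar>" using real_sqrt_less_mono by fastforce
  then obtain s where s: "sqrt (1 - 1 / y) < s" "s < \<bar>r\<bar>" using dense by blast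
  have s0: "0 < s" using s(1) y1 by (intro le_less_trans[OF _ s(1)]) auto
  have "(sqrt (1 - 1 / y))\<^sup>2 < s\<^sup>2"
    using s(1) y1 by (intro power_strict_mono) auto
  then have "1 - 1 / y < s\<^sup>2" using y1 by simp
  then have \<kappa>: "0 \<le> \<kappa>" "\<kappa> / s\<^sup>2 < 1 + \<kappa>"
    using y1 s0 by (auto simp: \<kappa>_def field_simps)
  have tc: "0 < tail_const s \<kappa>"
    using \<kappa> by (auto simp: tail_const_def)
  have "(\<lambda>n. ln (tail_const s \<kappa>) / real n) \<longlonglongrightarrow> 0"
    by (rule lim_const_over_n)
  then have "\<forall>\<^sub>F n in sequentially. ln (tail_const s \<kappa>) / real n < e / 2"
    using e by (intro order_tendstoD(2)) auto
  moreover have "\<forall>\<^sub>F n in sequentially. s < S n z / sqrt (real n)"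
    using lim s(2) by (intro order_tendstoD(1)) auto
  ultimately show ?thesis
    using pos eventually_gt_at_top[of 0]
  proof eventually_elim
    case (elim n)
    have "null_tail S n (S n z) \<le> tail_const s \<kappa> / sqrt (1 + \<kappa>) ^ n"
      using elim by (intro null_tail_upper_bound[OF le s0 \<kappa>]) (auto simp: field_simps)
    then have "ln (null_tail S n (S n z)) \<le> ln (tail_const s \<kappa> / sqrt (1 + \<kappa>) ^ n)"
      using elim(3) tc \<kappa> by (subst ln_le_cancel_iff) auto
    also have "\<dots> = ln (tail_const s \<kappa>) + real n * (- ln y / 2)"
      using tc y1 by (simp add: ln_divide_pos ln_realpow ln_sqrt \<kappa>_def)
    finally have "1 / real n * ln (null_tail S n (S n z)) \<le> ln (tail_const s \<kappa>) / real n + - ln y / 2"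
      using elim(4) by (simp add: field_simps)
    then show ?case using elim(1) lny by linarith
  qed
qed

text \<open>The exponential tail bound gives the upper half and Bahadur's bound at
  \<open>proj0 \<theta>\<close> the lower half. They meet, so the liminf defining the slope is a
  genuine limit.\<close>

lemma log_null_tail_tendsto:
  fixes M :: "'a measure" and Z :: "nat \<Rightarrow> 'a \<Rightarrow> real^2"
  assumes M: "prob_space M" and \<theta>: "\<theta> \<in> Theta1"
    and indep: "prob_space.indep_vars M (\<lambda>_. borel) Z {1..}"
    and distr: "\<And>i. 1 \<le> i \<Longrightarrow> distr M borel (Z i) = gauss_law \<theta>"
    and le: "\<And>n z. S n z \<le> sqrt (real n) * \<bar>pearson n z\<bar>"
    and lim: "AE \<omega> in M. (\<lambda>n. S n (\<lambda>i. Z i \<omega>) / sqrt (real n)) \<longlonglongrightarrow> \<bar>corr \<theta>\<bar>"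
  shows "AE \<omega> in M. (\<lambda>n. 1 / real n * ln (null_tail S n (S n (\<lambda>i. Z i \<omega>)))) \<longlonglongrightarrow> ln (1 - (corr \<theta>)\<^sup>2) / 2"
proof -
  interpret prob_space M by fact
  have \<theta>': "\<theta> \<in> Theta" "corr \<theta> \<noteq> 0"
    using \<theta> by (auto simp: Theta1_def Theta0_def)
  define L where "L = ln (1 - (corr \<theta>)\<^sup>2) / 2"
  have "KL_info \<theta> (proj0 \<theta>) = - L"
    using KL_info_proj0[OF \<theta>'(1)] by (simp add: L_def)
  then have "AE \<omega> in M. \<forall>\<^sub>F n in sequentially. exp (- real n * (- L + 2 * (1 / real (Suc k)))) < null_tail S n (S n (\<lambda>i. Z i \<omega>))" for k
    using null_tail_lower_bound[OF M \<theta>'(1) proj0_in_Theta0[OF \<theta>'(1)] _ indep distr, of "1 / real (Suc k)"] by simp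
  \<comment> \<open>Restricting \<delta> to 1 / (k + 1) leaves countably many exceptional null sets,
    which can be merged.\<close>
  then have "AE \<omega> in M. \<forall>k. \<forall>\<^sub>F n in sequentially. exp (- real n * (- L + 2 * (1 / real (Suc k)))) < null_tail S n (S n (\<lambda>i. Z i \<omega>))"
    by (subst AE_all_countable) simp
  then show ?thesis
    using lim unfolding L_def[symmetric]
  proof eventually_elim
    case (elim \<omega>)
    let ?z = "\<lambda>i. Z i \<omega>"
    show ?case
    proof (rule order_tendstoI)
      fix a assume "a < L"
      then obtain k where k: "inverse (real (Suc k)) < (L - a) / 2"
        using reals_Archimedean[of "(L - a) / 2"] by auto
      show "\<forall>\<^sub>F n in sequentially. a < 1 / real n * ln (null_tail S n (S n ?z))"
        using spec[OF elim(1), of k] eventually_gt_at_top[of 0]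
      proof eventually_elim
        case (elim n)
        have "- real n * (- L + 2 * (1 / real (Suc k))) < ln (null_tail S n (S n ?z))"
          using elim(1) less_trans[OF exp_gt_zero elim(1)] by (subst ln_exp[symmetric], subst ln_less_cancel_iff) auto
        moreover have "real n * a < - real n * (- L + 2 * (1 / real (Suc k)))"
        proof -
          have "real n * a < real n * (L - 2 * (1 / real (Suc k)))"
            using elim(2) k by (intro mult_strict_left_mono) (auto simp: inverse_eq_divide)
          then show ?thesis by (simp add: algebra_simps)
        qed
        ultimately have "real n * a < ln (null_tail S n (S n ?z))" by linarith
        then show ?case using elim(2) by (simp add: field_simps)
      qed
    next
      fix a assume a: "L < a"
      \<comment> \<open>With \<open>ln 0 = 0\<close>, a vanishing p-value would break the comparison
        of logarithms; any single instance of the lower bound rules it out.\<close>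
      have "\<forall>\<^sub>F n in sequentially. 0 < null_tail S n (S n ?z)"
        using spec[OF elim(1), of 0] by eventually_elim (rule less_trans[OF exp_gt_zero])
      from eventually_log_null_tail_less[OF le _ _ elim(2) this, of "a - L"]
      show "\<forall>\<^sub>F n in sequentially. 1 / real n * ln (null_tail S n (S n ?z)) < a"
        using a \<theta>' Theta_params(3)[OF \<theta>'(1)] by (simp add: L_def)
    qed
  qed
qed

text \<open>Comparing the almost sure limit of the log \<open>p\<close>-value with Bahadur's bound for each
  \<open>\<theta>0\<close> shows that \<open>KL_info \<theta>\<close> is minimised over \<^const>\<open>Theta0\<close> at
  \<^term>\<open>proj0 \<theta>\<close>; no direct minimisation is needed.\<close>

lemma exact_slope_optimal:
  fixes M :: "'a measure" and Z :: "nat \<Rightarrow> 'a \<Rightarrow> real^2"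
  assumes M: "prob_space M" and \<theta>: "\<theta> \<in> Theta1"
    and indep: "prob_space.indep_vars M (\<lambda>_. borel) Z {1..}"
    and distr: "\<And>i. 1 \<le> i \<Longrightarrow> distr M borel (Z i) = gauss_law \<theta>"
    and le: "\<And>n z. S n z \<le> sqrt (real n) * \<bar>pearson n z\<bar>"
    and lim: "AE \<omega> in M. (\<lambda>n. S n (\<lambda>i. Z i \<omega>) / sqrt (real n)) \<longlonglongrightarrow> \<bar>corr \<theta>\<bar>"
  shows "AE \<omega> in M. exact_slope S (\<lambda>i. Z i \<omega>) = ereal (2 * J_info \<theta>)"
proof -
  interpret prob_space M by fact
  have \<theta>': "\<theta> \<in> Theta" using \<theta> by (auto simp: Theta1_def)
  define L where "L = ln (1 - (corr \<theta>)\<^sup>2) / 2"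
  have conv: "AE \<omega> in M. (\<lambda>n. 1 / real n * ln (null_tail S n (S n (\<lambda>i. Z i \<omega>)))) \<longlonglongrightarrow> L"
    unfolding L_def by (rule log_null_tail_tendsto[OF assms])
  have KL: "- L \<le> KL_info \<theta> \<theta>0" if \<theta>0: "\<theta>0 \<in> Theta0" for \<theta>0
  proof (rule field_le_epsilon)
    fix e :: real assume "0 < e"
    then have "AE \<omega> in M. \<forall>\<^sub>F n in sequentially. exp (- real n * (KL_info \<theta> \<theta>0 + e)) < null_tail S n (S n (\<lambda>i. Z i \<omega>))"
      using null_tail_lower_bound[OF M \<theta>' \<theta>0 _ indep distr, of "e / 2"] by simp
    with conv have "AE \<omega> in M. - L \<le> KL_info \<theta> \<theta>0 + e"
    proof eventually_elim
      case (elim \<omega>)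
      have "\<forall>\<^sub>F n in sequentially. - (KL_info \<theta> \<theta>0 + e) \<le> 1 / real n * ln (null_tail S n (S n (\<lambda>i. Z i \<omega>)))"
        using elim(2) eventually_gt_at_top[of 0]
      proof eventually_elim
        case (elim n)
        have "- real n * (KL_info \<theta> \<theta>0 + e) < ln (null_tail S n (S n (\<lambda>i. Z i \<omega>)))"
          using elim(1) less_trans[OF exp_gt_zero elim(1)] by (subst ln_exp[symmetric], subst ln_less_cancel_iff) auto
        then show ?case using elim(2) by (simp add: field_simps)
      qed
      from tendsto_lowerbound[OF elim(1) this] show ?case by simp
    qed
    \<comment> \<open>The inequality no longer involves \<omega>, and in a probability space a
      constant statement that holds almost surely holds.\<close>
    then show "- L \<le> KL_info \<theta> \<theta>0 + e" by simp
  qed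
  have "J_info \<theta> = - L"
    unfolding J_info_def
  proof (rule cInf_eq_minimum)
    show "- L \<in> KL_info \<theta> ` Theta0"
      using KL_info_proj0[OF \<theta>'] proj0_in_Theta0[OF \<theta>'] by (intro image_eqI[of _ _ "proj0 \<theta>"]) (auto simp: L_def)
  qed (use KL in auto)
  from conv show ?thesis
  proof eventually_elim
    case (elim \<omega>)
    have "liminf (\<lambda>n. ereal (1 / real n * ln (null_tail S n (S n (\<lambda>i. Z i \<omega>))))) = ereal L"
      by (rule lim_imp_Liminf) (use elim in auto)
    then show ?case
      using \<open>J_info \<theta> = - L\<close> by (simp add: exact_slope_def)
  qed
qed

end

theorem proposition5p3:
  fixes M :: "'a measure" and Z :: "nat \<Rightarrow> 'a \<Rightarrow> real^2" and \<theta> :: param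
  assumes "prob_space M"
    and "\<theta> \<in> Theta1"
    and "prob_space.indep_vars M (\<lambda>_. borel) Z {1..}"
    and "\<And>i. i \<ge> 1 \<Longrightarrow> distr M borel (Z i) = gauss_law \<theta>"
  shows "(AE \<omega> in M. exact_slope (\<lambda>n z. \<bar>sqrt (real n) * pearson n z\<bar>) (\<lambda>i. Z i \<omega>)
            = ereal (2 * J_info \<theta>))
    \<and> (corr \<theta> > 0 \<longrightarrow>
         (AE \<omega> in M. exact_slope (\<lambda>n z. sqrt (real n) * pearson n z) (\<lambda>i. Z i \<omega>)
            = ereal (2 * J_info \<theta>)))"
proof -
  have \<theta>: "\<theta> \<in> Theta" using assms(2) by (auto simp: Theta1_def)
  have lim: "AE \<omega> in M. (\<lambda>n. pearson n (\<lambda>i. Z i \<omega>)) \<longlonglongrightarrow> corr \<theta>"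
    by (rule pearson_tendsto_corr[OF assms(1) \<theta> assms(3,4)])
  interpret abs: sample_statistic "\<lambda>n z. \<bar>sqrt (real n) * pearson n z\<bar>"
    by standard (measurable, simp only: pearson_restrict)
  interpret signed: sample_statistic "\<lambda>n z. sqrt (real n) * pearson n z"
    by standard (measurable, simp only: pearson_restrict)
  have "AE \<omega> in M. (\<lambda>n. \<bar>sqrt (real n) * pearson n (\<lambda>i. Z i \<omega>)\<bar> / sqrt (real n)) \<longlonglongrightarrow> \<bar>corr \<theta>\<bar>"
    using lim
  proof eventually_elim
    case (elim \<omega>)
    \<comment> \<open>Cancelling sqrt n requires n > 0, hence an eventual identity.\<close>
    have "\<forall>\<^sub>F n in sequentially. \<bar>pearson n (\<lambda>i. Z i \<omega>)\<bar> = \<bar>sqrt (real n) * pearson n (\<lambda>i. Z i \<omega>)\<bar> / sqrt (real n)"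
      using eventually_gt_at_top[of 0] by eventually_elim (simp add: abs_mult)
    with tendsto_rabs[OF elim] show ?case by (rule Lim_transform_eventually)
  qed
  then have "AE \<omega> in M. exact_slope (\<lambda>n z. \<bar>sqrt (real n) * pearson n z\<bar>) (\<lambda>i. Z i \<omega>) = ereal (2 * J_info \<theta>)"
    by (intro abs.exact_slope_optimal[OF assms]) (auto simp: abs_mult)
  \<comment> \<open>The normalised signed statistic converges to the correlation itself, which is
    the required |\<rho>| because the correlation is positive here.\<close>
  moreover have "AE \<omega> in M. exact_slope (\<lambda>n z. sqrt (real n) * pearson n z) (\<lambda>i. Z i \<omega>) = ereal (2 * J_info \<theta>)"
    if "corr \<theta> > 0"
  proof (rule signed.exact_slope_optimal[OF assms])
    show "sqrt (real n) * pearson n z \<le> sqrt (real n) * \<bar>pearson n z\<bar>" for n z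
      by (intro mult_left_mono) auto
    show "AE \<omega> in M. (\<lambda>n. sqrt (real n) * pearson n (\<lambda>i. Z i \<omega>) / sqrt (real n)) \<longlonglongrightarrow> \<bar>corr \<theta>\<bar>"
      using lim
    proof eventually_elim
      case (elim \<omega>)
      have "\<forall>\<^sub>F n in sequentially. pearson n (\<lambda>i. Z i \<omega>) = sqrt (real n) * pearson n (\<lambda>i. Z i \<omega>) / sqrt (real n)"
        using eventually_gt_at_top[of 0] by eventually_elim simp
      with elim show ?case using that by (auto intro: Lim_transform_eventually)
    qed
  qed
  ultimately show ?thesis by blast
qed

end
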